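(* Let $A$ be a multiplicative character of $\mathbb{F}_q$ with $A^2\neq\varepsilon$ and $A^6\neq\varepsilon$. Then \begin{align*} {}_3F_2(A^2,A^6,A^4\varphi;\,A^8,A^4\mid -8)&=\frac{\overline{A}(256)\,g(A^2)^2\,g(\overline{A^6})}{q\,g(\overline{A^2})}\left[\binom{A^3}{A^2}+\binom{A^3\varphi}{A^2}\right]^2-\frac{\overline{A}(4096)}{q}\\ &\quad-\frac{q-1}{q^3}\,\overline{A}(4096)\,\varphi(2)\,g(\overline{A^2}\varphi)\,g(A^2\varphi)\,\delta(A^4\varphi). \end{align*}
   Context: Let $p$ be an odd prime, $q=p^r$, and $\mathbb{F}_q$ the field with $q$ elements. Multiplicative characters of $\mathbb{F}_q^\times$ are extended to $\mathbb{F}_q$ by $\chi(0)=0$ (including the trivial character $\varepsilon$). $\varphi$ is the quadratic character. Characters are multiplied pointwise and $\overline{A}$ is the inverse of $A$. For a character $A$, $\delta(A)=1$ if $A=\varepsilon$ and $0$ otherwise. The Gauss sum is $g(\chi)=\sum_{x\in\mathbb{F}_q}\chi(x)\theta(x)$ with $\theta(\alpha)=\zeta_p^{\mathrm{tr}(\alpha)}$, $\zeta_p$ a fixed primitive $p$-th root of unity, $\mathrm{tr}$ the trace to $\mathbb{F}_p$. The binomial coefficient is $\binom{A}{B}=\frac{B(-1)}{q}\sum_{x\in\mathbb{F}_q}A(x)\overline{B}(1-x)$. Greene's series: ${}_{n+1}F_n(A_0,\dots,A_n;\,B_1,\dots,B_n\mid x)=\frac{q}{q-1}\sum_{\chi}\binom{A_0\chi}{\chi}\prod_{i=1}^n\binom{A_i\chi}{B_i\chi}\chi(x)$,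 summed over all multiplicative characters $\chi$.
   Formalization: The hypothesis p ≠ 3 is added: in characteristic 3 the stated formula is false (the sides differ by 1/q for every admissible A); e.g. for q = 9 and A of order 4 the left side is 2/9 and the right side is 1/3. *)

theory Defs
  imports
    "HOL-Number_Theory.Number_Theory"
    "HOL-Library.Function_Algebras"
    "HOL-Library.Function_Division"
    "HOL-Library.FuncSet"
    "HOL-Library.Cardinality"
    Complex_Main
begin

text \<open>
  Multiplicative characters of a finite field \<open>'a\<close> are functions \<open>'a \<Rightarrow> complex\<close>, extended by
  \<open>\<chi> 0 = 0\<close>.  Products, powers and inverses of characters are the pointwise ones of
  \<open>Function_Algebras\<close> and \<open>Function_Division\<close>; since \<open>inverse 0 = 0\<close> in Isabelle,
  \<open>inverse A\<close> is again extended by \<open>0\<close>.  Beware that the pointwise unit \<open>1\<close> (hence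
  \<open>A ^ 0\<close>) is the constant function \<open>1\<close>, which differs at \<open>0\<close> from the trivial
  character \<open>trivial_char\<close>.
\<close>

definition mult_char :: "('a::finite_field \<Rightarrow> complex) \<Rightarrow> bool" where
  "mult_char \<chi> \<longleftrightarrow> \<chi> 0 = 0 \<and> \<chi> 1 = 1 \<and> (\<forall>x y. \<chi> (x * y) = \<chi> x * \<chi> y)"

definition trivial_char :: "'a::finite_field \<Rightarrow> complex" where
  "trivial_char x = (if x = 0 then 0 else 1)"

definition quadratic_char :: "'a::finite_field \<Rightarrow> complex" where
  "quadratic_char x = (if x = 0 then 0 else if \<exists>y. x = y ^ 2 then 1 else - 1)"

definition char_delta :: "('a::finite_field \<Rightarrow> complex) \<Rightarrow> complex" where
  "char_delta A = (if A = trivial_char then 1 else 0)"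

definition primitive_root_unity :: "nat \<Rightarrow> complex \<Rightarrow> bool" where
  "primitive_root_unity n \<zeta> \<longleftrightarrow> n > 0 \<and> \<zeta> ^ n = 1 \<and> (\<forall>k. 0 < k \<and> k < n \<longrightarrow> \<zeta> ^ k \<noteq> 1)"

text \<open>
  The trace from the field with \<open>p ^ r\<close> elements to its prime field, as a sum of Frobenius
  conjugates.
\<close>

definition field_trace :: "nat \<Rightarrow> nat \<Rightarrow> 'a::finite_field \<Rightarrow> 'a" where
  "field_trace p r x = (\<Sum>i<r. x ^ (p ^ i))"

text \<open>
  The trace lies in the prime field \<open>{of_nat k | k. k < p}\<close> of \<open>'a\<close>; the exponent is
  its unique representative below \<open>p\<close>.
\<close>

definition additive_char :: "nat \<Rightarrow> nat \<Rightarrow> complex \<Rightarrow> 'a::finite_field \<Rightarrow> complex" where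
  "additive_char p r \<zeta> x = \<zeta> ^ (THE k. k < p \<and> of_nat k = field_trace p r x)"

definition gauss_sum :: "nat \<Rightarrow> nat \<Rightarrow> complex \<Rightarrow> ('a::finite_field \<Rightarrow> complex) \<Rightarrow> complex" where
  "gauss_sum p r \<zeta> \<chi> = (\<Sum>x\<in>UNIV. \<chi> x * additive_char p r \<zeta> x)"

definition char_binom ::
  "('a::finite_field \<Rightarrow> complex) \<Rightarrow> ('a \<Rightarrow> complex) \<Rightarrow> complex" where
  "char_binom A B =
     B (- 1) / of_nat CARD('a) * (\<Sum>x\<in>UNIV. A x * inverse B (1 - x))"

text \<open>
  Greene's series with upper parameters \<open>As = [A\<^sub>0, \<dots>, A\<^sub>n]\<close> and lower parameters
  \<open>Bs = [B\<^sub>1, \<dots>, B\<^sub>n]\<close>, so that \<open>B\<^sub>i\<close> is \<open>Bs ! (i - 1)\<close>; it is only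
  meaningful when \<open>length As = length Bs + 1\<close>.
\<close>

definition greene_series ::
  "('a::finite_field \<Rightarrow> complex) list \<Rightarrow> ('a \<Rightarrow> complex) list \<Rightarrow> 'a \<Rightarrow> complex" where
  "greene_series As Bs x =
     of_nat CARD('a) / (of_nat CARD('a) - 1) *
     (\<Sum>\<chi> | mult_char \<chi>.
        char_binom (As ! 0 * \<chi>) \<chi> *
        (\<Prod>i=1..length Bs. char_binom (As ! i * \<chi>) (Bs ! (i - 1) * \<chi>)) * \<chi> x)"

text \<open>The sum above is a genuine finite sum.\<close>

lemma finite_mult_chars: "finite {\<chi> :: 'a::finite_field \<Rightarrow> complex. mult_char \<chi>}"
proof -
  define n where "n = CARD('a)"
  have n: "n > 1"
    using card_mono[of "UNIV :: 'a set" "{0, 1}"] by (simp add: n_def)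
  have pow: "\<chi> (x ^ k) = \<chi> x ^ k" if "mult_char \<chi>" for \<chi> :: "'a \<Rightarrow> complex" and x k
    using that by (induction k) (auto simp: mult_char_def)
  define Z where "Z = insert 0 {z :: complex. z ^ (n - 1) = 1}"
  have "finite Z"
    using n by (simp add: Z_def finite_roots_unity)
  have "\<chi> x \<in> Z" if "mult_char \<chi>" for \<chi> :: "'a \<Rightarrow> complex" and x
  proof -
    have "\<chi> x ^ n = \<chi> x"
      using pow[OF that, of x n] finite_field_power_card_eq_same[of x] by (simp add: n_def)
    hence "\<chi> x * (\<chi> x ^ (n - 1) - 1) = 0"
      using n by (cases n) (auto simp: algebra_simps)
    thus ?thesis
      by (auto simp: Z_def)
  qed
  hence "{\<chi> :: 'a \<Rightarrow> complex. mult_char \<chi>} \<subseteq> PiE UNIV (\<lambda>_. Z)"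
    by (auto simp: PiE_UNIV_domain)
  moreover have "finite (PiE (UNIV :: 'a set) (\<lambda>_. Z))"
    using \<open>finite Z\<close> by (intro finite_PiE) auto
  ultimately show ?thesis
    by (rule finite_subset)
qed

end

(* The identity depends only on \<chi> = A^2, which satisfies \<chi>(-1) = 1.

   Left side.  Orthogonality of characters turns the series into a double sum, which after
   rational substitutions becomes the sum over n of \<chi>(n) times the sum over k of
   \<phi>((k^2 - 3n)^2 - 8n(1 - n)k).

   Right side.  Let S be q times the bracket.  By the quadratic Hasse-Davenport relation the Gauss
   sum factor times S^2 is |S|^2 times a character value.  Moreover S is the complex conjugate of
   R = sum of \<chi>(s^3 - s), and sorting the terms of |R|^2 by n = (s^3 - s)/(t^3 - t) gives the sum
   over n of \<chi>(n) times the sum over m of \<phi>((m - n)(m^3 - n)).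

   The two quartics have the same classical invariants up to scaling, so both genus one curves have
   the Weierstrass form y^2 = x^3 + 3n x^2 + n^2 (1 - n)^2, and the inner sums agree up to explicit
   corrections.  The term with \<delta> comes from the fibre lost in a substitution. *)

theory Submission
  imports Defs "HOL-Computational_Algebra.Polynomial"
begin

section \<open>Multiplicative characters of finite fields\<close>

text \<open>For general n the inner sums count points on elliptic curves and have no closed form, so
  the two sides are compared fibre by fibre over n. The argument -8 singles itself out here. With -c
  in its place the quartic in k would be k^4 + (2 - c) n k^2 - c n (1 - n) k + (1 + c) n^2. Its even
  part is the square of a polynomial for all n only when c = 0 or c = 8, and this is what removes
  the linear term from the cubic attached to it. Write T for the sum of \<chi>(n) times the common
  cubic sum. The left double sum is q + T, where the q comes from the degenerate fibre n = 1, while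
  |R|^2 is 2q + T, where the 2q comes from m = 1 and m = -1. The difference -q becomes the term with
  1/q. The constant 4096 is 64^2: \<chi>(64) = A(4096) arises from squaring the new variable 8zw.
  Hasse-Davenport supplies A(16) = \<chi>(4), which leaves \<chi>(16) = A(256) in front of the
  bracket.\<close>

lemma finite_field_generator:
  obtains h :: "'a::finite_field" where
    "h \<noteq> 0" "\<And>x. x \<noteq> 0 \<Longrightarrow> \<exists>i. x = h ^ i"
    "\<And>i j. h ^ i = h ^ j \<longleftrightarrow> [i = j] (mod (CARD('a) - 1))"
proof -
  \<comment> \<open>Cyclicity of the unit group is a theorem of HOL-Algebra about ring records, so
    the type is wrapped as a record with carrier \<open>UNIV\<close>.\<close>
  define R :: "'a ring" where
    "R = \<lparr>carrier = UNIV, mult = (*), one = 1, zero = 0, add = (+)\<rparr>"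
  have R [simp]: "carrier R = UNIV" "mult R = (*)" "one R = 1" "zero R = 0" "add R = (+)"
    by (simp_all add: R_def)
  have inv1: "\<exists>y. x * y = 1" if "x \<noteq> 0" for x :: 'a
    using that by (intro exI[of _ "inverse x"]) simp
  have inv2: "\<exists>y. x + y = 0" for x :: 'a
    by (intro exI[of _ "- x"]) simp
  interpret field R
    by unfold_locales (auto simp: Units_def algebra_simps inv2 intro: inv1 dest: inv1)
  have pow: "x [^]\<^bsub>R\<^esub> i = x ^ i" for x :: 'a and i :: nat
    by (induction i) (simp_all add: mult.commute)
  obtain h where "h \<in> carrier (mult_of R)" "carrier (mult_of R) = {h [^]\<^bsub>R\<^esub> i |i::nat. i \<in> UNIV}"
    using finite_field_mult_group_has_gen by auto
  hence h: "h \<noteq> 0" "- {0} = range (\<lambda>i. h ^ i)"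
    by (auto simp: pow)
  define N where "N = CARD('a) - 1"
  have "CARD('a) > 1"
    using card_mono[of "UNIV :: 'a set" "{0, 1}"] by simp
  hence N: "N > 0" "CARD('a) = Suc N"
    by (auto simp: N_def)
  have hN: "h ^ N = 1"
    using finite_field_power_card_eq_same[of h] h(1) by (simp add: N)
  have hmod: "h ^ i = h ^ (i mod N)" for i
  proof -
    have "h ^ i = h ^ (N * (i div N) + i mod N)"
      by simp
    also have "\<dots> = h ^ (i mod N)"
      unfolding power_add power_mult hN by simp
    finally show ?thesis .
  qed
  have "(\<lambda>i. h ^ i) ` {..<N} = - {0}"
  proof
    show "- {0} \<subseteq> (\<lambda>i. h ^ i) ` {..<N}"
    proof
      fix x :: 'a assume "x \<in> - {0}"
      then obtain i where "x = h ^ i"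
        using h(2) by auto
      thus "x \<in> (\<lambda>i. h ^ i) ` {..<N}"
        using hmod[of i] N(1) by auto
    qed
  qed (use h in auto)
  moreover have "card (- {0 :: 'a}) = N"
    by (simp add: Compl_eq_Diff_UNIV card_Diff_subset N)
  ultimately have inj: "inj_on (\<lambda>i. h ^ i) {..<N}"
    by (intro eq_card_imp_inj_on) auto
  show ?thesis
  proof
    show "h ^ i = h ^ j \<longleftrightarrow> [i = j] (mod (CARD('a) - 1))" for i j
      using inj_on_eq_iff[OF inj, of "i mod N" "j mod N"] N(1) hmod[of i] hmod[of j]
      by (simp add: cong_def N)
    show "\<exists>i. x = h ^ i" if "x \<noteq> 0" for x
      using h(2) that by auto
  qed (fact h(1))
qed

lemma mult_char_0 [simp]: "mult_char \<chi> \<Longrightarrow> \<chi> 0 = 0"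
  and mult_char_1 [simp]: "mult_char \<chi> \<Longrightarrow> \<chi> 1 = 1"
  and mult_char_mult: "mult_char \<chi> \<Longrightarrow> \<chi> (x * y) = \<chi> x * \<chi> y"
  by (simp_all add: mult_char_def)

lemma mult_char_power: "mult_char \<chi> \<Longrightarrow> \<chi> (x ^ n) = \<chi> x ^ n"
  by (induction n) (simp_all add: mult_char_mult)

lemma mult_char_eq_0_iff [simp]: "mult_char \<chi> \<Longrightarrow> \<chi> x = 0 \<longleftrightarrow> x = 0"
  by (metis mult_char_0 mult_char_1 mult_char_mult mult_zero_left right_inverse zero_neq_one)

lemma mult_char_inverse:
  assumes "mult_char \<chi>"
  shows "\<chi> (inverse x) = inverse (\<chi> x)"
proof (cases "x = 0")
  case False
  hence "\<chi> x * \<chi> (inverse x) = 1"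
    using assms by (simp flip: mult_char_mult)
  thus ?thesis
    by (simp add: inverse_unique)
qed (use assms in auto)

lemma mult_char_divide: "mult_char \<chi> \<Longrightarrow> \<chi> (x / y) = \<chi> x / \<chi> y"
  by (simp add: divide_inverse mult_char_mult mult_char_inverse)

lemma mult_char_times [intro]: "mult_char \<chi> \<Longrightarrow> mult_char \<psi> \<Longrightarrow> mult_char (\<chi> * \<psi>)"
  unfolding mult_char_def[of "\<chi> * \<psi>"]
  by (simp add: mult_char_mult mult.assoc mult.left_commute)

lemma power_fun_apply: "(f ^ n) x = (f x :: 'b::monoid_mult) ^ n"
  by (induction n) simp_all

text \<open>The exponent is positive because the zeroth power is the constant 1, which does not
  vanish at 0.\<close>

lemma mult_char_pow [intro]: "mult_char \<chi> \<Longrightarrow> n > 0 \<Longrightarrow> mult_char (\<chi> ^ n)"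
  unfolding mult_char_def[of "\<chi> ^ n"]
  by (simp add: mult_char_mult power_fun_apply power_mult_distrib)

lemma mult_char_inverse_fun [intro]: "mult_char \<chi> \<Longrightarrow> mult_char (inverse \<chi>)"
  unfolding mult_char_def[of "inverse \<chi>"]
  by (simp add: mult_char_mult)

lemma mult_char_trivial: "mult_char trivial_char"
  by (simp add: mult_char_def trivial_char_def)

lemma mult_char_neg1_square: "mult_char \<chi> \<Longrightarrow> \<chi> (-1) * \<chi> (-1) = 1"
  by (simp flip: mult_char_mult)

lemma mult_char_minus: "mult_char \<chi> \<Longrightarrow> \<chi> (- x) = \<chi> (-1) * \<chi> x"
  by (simp flip: mult_char_mult)

text \<open>Since x^q = x, every nonzero value is a root of unity of order dividing q - 1.\<close>

lemma norm_mult_char: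
  fixes \<chi> :: "'a::finite_field \<Rightarrow> complex"
  assumes "mult_char \<chi>" "x \<noteq> 0"
  shows "norm (\<chi> x) = 1"
proof -
  have "CARD('a) > 1"
    using card_mono[of "UNIV :: 'a set" "{0, 1}"] by simp
  then obtain n where n: "CARD('a) = Suc n" "n > 0"
    by (cases "CARD('a)") auto
  have "\<chi> x ^ CARD('a) = \<chi> x"
    using assms by (simp flip: mult_char_power add: finite_field_power_card_eq_same)
  hence "\<chi> x ^ n = 1"
    using assms by (simp add: n)
  hence "norm (\<chi> x) ^ n = 1 ^ n"
    by (simp flip: norm_power)
  thus ?thesis
    using n by (intro power_eq_imp_eq_base[of "norm (\<chi> x)" n 1]) auto
qed

lemma cnj_mult_char:
  assumes "mult_char \<chi>"
  shows "cnj (\<chi> x) = inverse (\<chi> x)"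
proof (cases "x = 0")
  case False
  have "\<chi> x * cnj (\<chi> x) = 1"
    using norm_mult_char[OF assms False] by (simp flip: complex_norm_square)
  thus ?thesis
    by (rule inverse_unique [symmetric])
qed (use assms in simp)

lemma sum_mult_char:
  assumes \<chi>: "mult_char \<chi>" and "\<chi> \<noteq> trivial_char"
  shows "(\<Sum>x\<in>UNIV. \<chi> x) = 0"
proof -
  obtain a where a: "\<chi> a \<noteq> 1" "a \<noteq> 0"
    using assms by (metis (full_types) ext mult_char_0 trivial_char_def)
  have "(\<Sum>x\<in>UNIV. \<chi> x) = (\<Sum>x\<in>UNIV. \<chi> (a * x))"
    by (rule sum.reindex_bij_witness[of _ "\<lambda>x. a * x" "\<lambda>x. x / a"]) (use a in auto)
  also have "\<dots> = \<chi> a * (\<Sum>x\<in>UNIV. \<chi> x)"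
    using \<chi> by (simp add: mult_char_mult sum_distrib_left)
  finally show ?thesis
    using a by (simp add: algebra_simps)
qed

lemma sum_trivial_char: "(\<Sum>x\<in>UNIV. trivial_char (x :: 'a::finite_field)) = of_nat CARD('a) - 1"
proof -
  have "(\<Sum>x\<in>UNIV. trivial_char (x :: 'a)) = (\<Sum>x\<in>- {0::'a}. 1)"
    by (intro sum.mono_neutral_cong_right) (auto simp: trivial_char_def)
  thus ?thesis
    by (simp add: Compl_eq_Diff_UNIV card_Diff_subset of_nat_diff Suc_leI)
qed

text \<open>A generator h of the unit group and a primitive root of unity w of the same order give
  the character h^i \<mapsto> w^i. It is injective on units, so it separates every x from 1.\<close>

lemma separating_mult_char:
  assumes "x \<noteq> (1::'a::finite_field)" "x \<noteq> 0"
  obtains \<psi> where "mult_char \<psi>" "\<psi> x \<noteq> 1"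
proof -
  obtain h :: 'a where h: "h \<noteq> 0" "\<And>x. x \<noteq> 0 \<Longrightarrow> \<exists>i. x = h ^ i"
    "\<And>i j. h ^ i = h ^ j \<longleftrightarrow> [i = j] (mod (CARD('a) - 1))"
    using finite_field_generator by blast
  define N where "N = CARD('a) - 1"
  have N: "N > 0"
    using card_mono[of "UNIV :: 'a set" "{0, 1}"] by (simp add: N_def)
  define w where "w = cis (2 * pi / real N)"
  have wk: "w ^ k = cis (2 * pi * real k / real N)" for k
    by (simp add: w_def DeMoivre algebra_simps)
  have wN: "w ^ N = 1"
    using N by (simp add: wk)
  have wmod: "w ^ i = w ^ (i mod N)" for i
  proof -
    have "w ^ i = w ^ (N * (i div N) + i mod N)"
      by simp
    also have "\<dots> = w ^ (i mod N)"
      unfolding power_add power_mult wN by simp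
    finally show ?thesis .
  qed
  have inj: "inj_on (\<lambda>k. w ^ k) {..<N}"
    using bij_betw_imp_inj_on[OF bij_betw_roots_unity[OF N]] by (simp add: wk)
  have w_cong: "w ^ i = w ^ j \<longleftrightarrow> [i = j] (mod N)" for i j
    using inj_on_eq_iff[OF inj, of "i mod N" "j mod N"] N wmod[of i] wmod[of j]
    by (simp add: cong_def)
  define l where "l x = (SOME i. x = h ^ i)" for x
  have l: "x = h ^ l x" if "x \<noteq> 0" for x
    unfolding l_def using someI_ex[OF h(2)[OF that]] .
  define \<psi> where "\<psi> x = (if x = 0 then 0 else w ^ l x)" for x
  have \<psi>h: "\<psi> (h ^ i) = w ^ i" for i
    using l[of "h ^ i"] h(1) by (auto simp: \<psi>_def w_cong h(3) N_def cong_sym_eq)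
  show ?thesis
  proof
    have "\<psi> (x * y) = \<psi> x * \<psi> y" for x y
    proof (cases "x = 0 \<or> y = 0")
      case False
      then obtain i j where "x = h ^ i" "y = h ^ j"
        using h(2) by blast
      thus ?thesis
        using \<psi>h[of "i + j"] by (simp add: \<psi>h power_add)
    qed (auto simp: \<psi>_def)
    thus "mult_char \<psi>"
      using \<psi>h[of 0] by (simp add: mult_char_def \<psi>_def)
    obtain i where i: "x = h ^ i"
      using assms h(2) by blast
    hence "\<not> [i = 0] (mod N)"
      using assms h(3)[of i 0] by (simp add: N_def)
    thus "\<psi> x \<noteq> 1"
      using w_cong[of i 0] by (simp add: i \<psi>h)
  qed
qed

lemma sum_mult_chars:
  fixes x :: "'a::finite_field"
  shows "(\<Sum>\<psi> | mult_char \<psi>. \<psi> x) = (if x = 1 then of_nat CARD('a) - 1 else 0)"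
proof -
  have *: "(\<Sum>\<psi> | mult_char \<psi>. \<psi> x) = 0" if neq: "x \<noteq> 1" for x :: 'a
  proof (cases "x = 0")
    case False
    then obtain \<psi>0 where \<psi>0: "mult_char \<psi>0" "\<psi>0 x \<noteq> 1"
      using separating_mult_char[OF neq] by metis
    \<comment> \<open>The product of \<open>\<psi>0\<close> and its inverse is the trivial character
      and not the constant 1. Cancelling it is legitimate because every character vanishes at 0 as
      well.\<close>
    have *: "\<psi>0 y = 0 \<longrightarrow> \<psi> y = 0" if "mult_char \<psi>" for \<psi> y
      using that \<psi>0(1) by (cases "y = 0") simp_all
    have inv: "inverse \<psi>0 * (\<psi>0 * \<psi>) = \<psi>" "\<psi>0 * (inverse \<psi>0 * \<psi>) = \<psi>"
      if "mult_char \<psi>" for \<psi>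
      by (rule ext, use *[OF that] in \<open>simp add: field_simps\<close>)+
    have "(\<Sum>\<psi> | mult_char \<psi>. \<psi> x) = (\<Sum>\<psi> | mult_char \<psi>. (\<psi>0 * \<psi>) x)"
    proof (rule sum.reindex_bij_witness[of _ "\<lambda>\<psi>. \<psi>0 * \<psi>" "\<lambda>\<psi>. inverse \<psi>0 * \<psi>"])
      fix \<psi> assume "\<psi> \<in> {\<psi> :: 'a \<Rightarrow> complex. mult_char \<psi>}"
      hence \<psi>: "mult_char \<psi>" by simp
      show "\<psi>0 * (inverse \<psi>0 * \<psi>) = \<psi>" "inverse \<psi>0 * (\<psi>0 * \<psi>) = \<psi>"
        using inv[OF \<psi>] by blast+
      show "inverse \<psi>0 * \<psi> \<in> {\<psi>. mult_char \<psi>}" "\<psi>0 * \<psi> \<in> {\<psi>. mult_char \<psi>}"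
        using \<psi> \<psi>0 by (simp_all add: mult_char_times mult_char_inverse_fun)
      show "(\<psi>0 * (inverse \<psi>0 * \<psi>)) x = \<psi> x"
        by (simp only: inv[OF \<psi>])
    qed
    also have "\<dots> = \<psi>0 x * (\<Sum>\<psi> | mult_char \<psi>. \<psi> x)"
      by (simp add: sum_distrib_left)
    finally show ?thesis
      using \<psi>0 by (simp add: algebra_simps)
  qed auto
  \<comment> \<open>The number of characters is obtained by summing all values in both orders.\<close>
  have "(\<Sum>y\<in>UNIV. \<Sum>\<psi> | mult_char \<psi>. \<psi> (y::'a)) =
        (\<Sum>\<psi> | mult_char \<psi>. \<psi> (1::'a)) + (\<Sum>y\<in>UNIV - {1}. \<Sum>\<psi> | mult_char \<psi>. \<psi> (y::'a))"
    by (rule sum.remove) auto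
  also have "(\<Sum>y\<in>UNIV - {1}. \<Sum>\<psi> | mult_char \<psi>. \<psi> (y::'a)) = 0"
    using * by (intro sum.neutral) auto
  finally have "(\<Sum>\<psi> | mult_char \<psi>. \<psi> (1::'a)) = (\<Sum>y\<in>UNIV. \<Sum>\<psi> | mult_char \<psi>. \<psi> (y::'a))"
    by simp
  also have "\<dots> = (\<Sum>\<psi> | mult_char \<psi>. \<Sum>y\<in>UNIV. \<psi> (y::'a))"
    by (rule sum.swap)
  also have "\<dots> = (\<Sum>y\<in>UNIV. trivial_char (y::'a)) +
      (\<Sum>\<psi>\<in>{\<psi>. mult_char \<psi>} - {trivial_char}. \<Sum>y\<in>UNIV. \<psi> (y::'a))"
    by (rule sum.remove) (auto simp: finite_mult_chars mult_char_trivial)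
  also have "(\<Sum>\<psi>\<in>{\<psi>. mult_char \<psi>} - {trivial_char}. \<Sum>y\<in>UNIV. \<psi> (y::'a)) = 0"
    by (intro sum.neutral) (auto simp: sum_mult_char)
  finally show ?thesis
    using * by (simp add: sum_trivial_char)
qed

section \<open>The quadratic character\<close>

lemma sum_affine:
  fixes f :: "'a::finite_field \<Rightarrow> complex"
  assumes "a \<noteq> 0"
  shows "(\<Sum>x\<in>UNIV. f (a * x + b)) = (\<Sum>x\<in>UNIV. f x)"
  by (rule sum.reindex_bij_witness[of _ "\<lambda>x. (x - b) / a" "\<lambda>x. a * x + b"]) (use assms in auto)

lemma quadratic_char_0 [simp]: "quadratic_char 0 = 0"
  and quadratic_char_1 [simp]: "quadratic_char 1 = 1"
  by (auto simp: quadratic_char_def intro: exI[of _ 1])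

lemma quadratic_char_square [simp]: "quadratic_char (x ^ 2) = (if x = 0 then 0 else 1)"
  by (auto simp: quadratic_char_def)

lemma quadratic_char_times_self: "quadratic_char x * quadratic_char x = trivial_char x"
  by (simp add: quadratic_char_def trivial_char_def)

lemma inverse_quadratic_char [simp]: "inverse (quadratic_char x) = quadratic_char x"
  by (simp add: quadratic_char_def)

context
  assumes odd_card: "odd CARD('a::finite_field)"
begin

lemma two_neq_0: "(2::'a) \<noteq> 0"
proof
  assume "(2::'a) = 0"
  hence "of_nat 2 = (0::'a)"
    by simp
  hence "CHAR('a) dvd 2"
    by (simp only: of_nat_eq_0_iff_char_dvd)
  hence "CHAR('a) = 2"
    using prime_CHAR_semidom[where ?'a = 'a, OF CHAR_pos] primes_dvd_imp_eq two_is_prime_nat by blast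
  thus False
    using CHAR_dvd_CARD[where ?'a = 'a] odd_card by simp
qed

text \<open>Squares are exactly the even powers of a generator. The sign rule on exponents makes
  multiplicativity immediate, in particular for a product of two nonsquares.\<close>

lemma quadratic_char_generator:
  obtains h :: 'a where "h \<noteq> 0" "\<And>x. x \<noteq> 0 \<Longrightarrow> \<exists>i. x = h ^ i"
    "\<And>i. quadratic_char (h ^ i) = (-1) ^ i"
proof -
  obtain h :: 'a where h: "h \<noteq> 0" "\<And>x. x \<noteq> 0 \<Longrightarrow> \<exists>i. x = h ^ i"
    "\<And>i j. h ^ i = h ^ j \<longleftrightarrow> [i = j] (mod (CARD('a) - 1))"
    using finite_field_generator by blast
  have "quadratic_char (h ^ i) = (-1) ^ i" for i
  proof (cases "even i")
    case True
    then obtain j where "h ^ i = (h ^ j) ^ 2"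
      by (metis dvd_def mult.commute power_mult)
    thus ?thesis
      using True h(1) by (simp del: power_mult)
  next
    case False
    have "h ^ i \<noteq> y ^ 2" for y
    proof
      assume eq: "h ^ i = y ^ 2"
      hence "y \<noteq> 0"
        using h(1) by auto
      then obtain j where "y = h ^ j"
        using h(2) by blast
      hence "[i = j * 2] (mod (CARD('a) - 1))"
        using eq h(3)[of i "j * 2"] by (simp add: power_mult)
      \<comment> \<open>As q is odd, 2 divides q - 1, so the parity of an exponent is well
        defined.\<close>
      hence "[i = j * 2] (mod 2)"
        by (rule cong_dvd_modulus_nat) (use odd_card in simp)
      thus False
        using False by (simp add: cong_def) presburger
    qed
    thus ?thesis
      using False h(1) by (simp add: quadratic_char_def)
  qed
  thus ?thesis
    using that h by blast
qed

lemma mult_char_quadratic: "mult_char (quadratic_char :: 'a \<Rightarrow> complex)"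
proof -
  obtain h :: 'a where h: "h \<noteq> 0" "\<And>x. x \<noteq> 0 \<Longrightarrow> \<exists>i. x = h ^ i"
    "\<And>i. quadratic_char (h ^ i) = (-1) ^ i"
    using quadratic_char_generator by blast
  have "quadratic_char (x * y) = quadratic_char x * quadratic_char y" for x y :: 'a
  proof (cases "x = 0 \<or> y = 0")
    case False
    then obtain i j where "x = h ^ i" "y = h ^ j"
      using h(2) by blast
    thus ?thesis
      using h(3)[of "i + j"] by (simp add: h(3) power_add)
  qed auto
  thus ?thesis
    by (simp add: mult_char_def)
qed

lemma quadratic_char_neq_trivial: "(quadratic_char :: 'a \<Rightarrow> complex) \<noteq> trivial_char"
proof -
  obtain h :: 'a where "h \<noteq> 0" "quadratic_char h = -1"
    using quadratic_char_generator by (metis power_one_right)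
  thus ?thesis
    by (auto simp: trivial_char_def fun_eq_iff intro!: exI[of _ h])
qed

lemma sum_quadratic_char: "(\<Sum>x\<in>UNIV. quadratic_char (x :: 'a)) = 0"
  using sum_mult_char mult_char_quadratic quadratic_char_neq_trivial by blast

lemma quadratic_char_mult_square:
  "x \<noteq> 0 \<Longrightarrow> quadratic_char (x ^ 2 * y) = quadratic_char (y :: 'a)"
  by (simp add: mult_char_mult[OF mult_char_quadratic])

lemma card_square_roots: "of_nat (card {s :: 'a. s ^ 2 = v}) = 1 + quadratic_char v"
proof (cases "\<exists>y. v = y ^ 2")
  case True
  then obtain y where y: "v = y ^ 2"
    by blast
  have "{s. s ^ 2 = v} = {y, - y}"
    by (auto simp: y power2_eq_iff)
  moreover have "y = - y \<longleftrightarrow> y = 0"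
    using two_neq_0 by (metis add.inverse_neutral add.right_inverse mult_2 mult_eq_0_iff)
  ultimately show ?thesis
    by (cases "y = 0") (auto simp: y card_insert_if)
next
  case False
  hence "{s. s ^ 2 = v} = {}" "v \<noteq> 0"
    by (auto intro: exI[of _ 0])
  thus ?thesis
    using False by (simp add: quadratic_char_def)
qed

text \<open>Sorting by v = s^2 weights each v with its number of square roots. The weight 1 +
  \<phi>(v) is also how a sum twisted by \<phi> is combined with the untwisted one later.\<close>

lemma sum_over_squares:
  fixes f :: "'a \<Rightarrow> complex"
  shows "(\<Sum>s\<in>UNIV. f (s ^ 2)) = (\<Sum>v\<in>UNIV. (1 + quadratic_char v) * f v)"
proof -
  have "(\<Sum>s\<in>UNIV. f (s ^ 2)) = (\<Sum>s\<in>UNIV. \<Sum>v\<in>UNIV. if s ^ 2 = v then f v else 0)"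
    by simp
  also have "\<dots> = (\<Sum>v\<in>UNIV. \<Sum>s\<in>UNIV. if s ^ 2 = v then f v else 0)"
    by (rule sum.swap)
  also have "\<dots> = (\<Sum>v\<in>UNIV. of_nat (card {s :: 'a. s ^ 2 = v}) * f v)"
    by (simp add: sum.If_cases)
  finally show ?thesis
    by (simp add: card_square_roots)
qed

lemma sum_quadratic_char_shift: "(\<Sum>x\<in>UNIV. quadratic_char (x + c :: 'a)) = 0"
  using sum_affine[of 1 quadratic_char c] by (simp add: sum_quadratic_char)

text \<open>After v = x^2 the product v (v - d) is a square times 1 - d/v. The variable w = 1 - d/v
  takes every value except 1, and the missing \<phi>(1) is the result up to sign.\<close>

lemma sum_quadratic_char_square_minus:
  assumes "d \<noteq> 0"
  shows "(\<Sum>x\<in>UNIV. quadratic_char (x ^ 2 - d :: 'a)) = -1"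
proof -
  have "(\<Sum>x\<in>UNIV. quadratic_char (x ^ 2 - d)) =
        (\<Sum>v\<in>UNIV. (1 + quadratic_char v) * quadratic_char (v - d))"
    by (rule sum_over_squares)
  also have "\<dots> = (\<Sum>v\<in>UNIV. quadratic_char (v - d)) + (\<Sum>v\<in>UNIV. quadratic_char v * quadratic_char (v - d))"
    by (simp add: ring_distribs sum.distrib)
  also have "(\<Sum>v\<in>UNIV. quadratic_char (v - d)) = 0"
    using sum_quadratic_char_shift[of "- d"] by simp
  also have "(\<Sum>v\<in>UNIV. quadratic_char v * quadratic_char (v - d)) =
      (\<Sum>v\<in>UNIV - {0}. quadratic_char (v ^ 2 * (1 - d / v)))"
  proof (intro sum.mono_neutral_cong_right ballI)
    fix v :: 'a assume "v \<in> UNIV - {0}"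
    hence "v * (v - d) = v ^ 2 * (1 - d / v)"
      by (simp add: field_simps power2_eq_square)
    thus "quadratic_char v * quadratic_char (v - d) = quadratic_char (v ^ 2 * (1 - d / v))"
      by (simp flip: mult_char_mult[OF mult_char_quadratic])
  qed auto
  also have "\<dots> = (\<Sum>w\<in>UNIV - {1::'a}. quadratic_char w)"
    by (rule sum.reindex_bij_witness[of _ "\<lambda>w. d / (1 - w)" "\<lambda>v. 1 - d / v"])
      (use assms in \<open>auto simp: quadratic_char_mult_square\<close>)
  also have "\<dots> = -1"
    using sum.remove[of UNIV "1::'a" "quadratic_char"] sum_quadratic_char
    by (simp add: add_eq_0_iff)
  finally show ?thesis
    by simp
qed

lemma sum_quadratic_char_quadratic:
  assumes "a \<noteq> 0" "b ^ 2 - 4 * a * c \<noteq> 0"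
  shows "(\<Sum>x\<in>UNIV. quadratic_char (a * x ^ 2 + b * x + c :: 'a)) = - quadratic_char a"
proof -
  have "quadratic_char (a * x ^ 2 + b * x + c) =
        quadratic_char a * quadratic_char ((2 * a * x + b) ^ 2 - (b ^ 2 - 4 * a * c))" for x
  proof -
    have "quadratic_char a * quadratic_char ((2 * a * x + b) ^ 2 - (b ^ 2 - 4 * a * c)) =
      quadratic_char ((2 * a) ^ 2 * (a * x ^ 2 + b * x + c))"
      unfolding mult_char_mult[OF mult_char_quadratic, symmetric]
      by (rule arg_cong[of _ _ quadratic_char]) (simp add: algebra_simps power2_eq_square)
    also have "\<dots> = quadratic_char (a * x ^ 2 + b * x + c)"
      using assms two_neq_0 by (intro quadratic_char_mult_square) auto
    finally show ?thesis ..
  qed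
  hence "(\<Sum>x\<in>UNIV. quadratic_char (a * x ^ 2 + b * x + c)) =
    quadratic_char a * (\<Sum>x\<in>UNIV. quadratic_char ((2 * a * x + b) ^ 2 - (b ^ 2 - 4 * a * c)))"
    by (simp add: sum_distrib_left)
  also have "(\<Sum>x\<in>UNIV. quadratic_char ((2 * a * x + b) ^ 2 - (b ^ 2 - 4 * a * c))) =
    (\<Sum>y\<in>UNIV. quadratic_char (y ^ 2 - (b ^ 2 - 4 * a * c)))"
    using assms two_neq_0
    by (intro sum_affine[of _ "\<lambda>y. quadratic_char (y ^ 2 - (b ^ 2 - 4 * a * c))"]) simp
  finally show ?thesis
    using assms by (simp add: sum_quadratic_char_square_minus)
qed

end

section \<open>Gauss and Jacobi sums\<close>

context
  fixes p r :: nat and \<zeta> :: complex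
  assumes prime_p: "prime p" and card: "CARD('a::finite_field) = p ^ r"
    and \<zeta>: "primitive_root_unity p \<zeta>"
begin

lemma CHAR_eq: "CHAR('a) = p"
  using prime_CHAR_semidom[where ?'a = 'a, OF CHAR_pos] CHAR_dvd_CARD[where ?'a = 'a]
    card prime_p primes_dvd_imp_eq prime_dvd_power by metis

lemma exponent_pos: "r > 0"
proof (rule ccontr)
  assume "\<not> r > 0"
  hence "CARD('a) = 1"
    using card by simp
  thus False
    using card_mono[of "UNIV :: 'a set" "{0, 1}"] by simp
qed

lemma field_trace_add:
  "field_trace p r (x + y :: 'a) = field_trace p r x + field_trace p r y"
  using freshmans_dream'[where ?'a = 'a, of "p ^ _" _ x y] prime_p
  by (simp add: field_trace_def CHAR_eq sum.distrib)

lemma of_nat_power_prime: "of_nat k ^ p = (of_nat k :: 'a)"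
proof (induction k)
  case (Suc k)
  thus ?case
    using freshmans_dream[where ?'a = 'a and x = 1 and y = "of_nat k"] prime_p
    by (simp add: CHAR_eq)
qed (use prime_p prime_gt_0_nat in auto)

text \<open>The polynomial x^p - x has at most p roots, and the p distinct images of the numbers
  below p already are roots.\<close>

lemma prime_field_eq: "{x :: 'a. x ^ p = x} = of_nat ` {..<p}"
proof (rule sym, rule card_subset_eq)
  have p1: "p > 1"
    using prime_p prime_gt_1_nat by blast
  define f :: "'a poly" where "f = monom 1 p + monom (- 1) 1"
  have deg: "degree f = p"
    unfolding f_def using p1 by (subst degree_add_eq_left) (auto simp: degree_monom_eq)
  hence "f \<noteq> 0"
    using p1 by auto
  moreover have "{x. poly f x = 0} = {x :: 'a. x ^ p = x}"
    by (auto simp: f_def poly_monom)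
  ultimately have le: "card {x :: 'a. x ^ p = x} \<le> p"
    using card_poly_roots_bound[of f] deg by simp
  have "inj_on (of_nat :: nat \<Rightarrow> 'a) {..<p}"
    by (auto simp: inj_on_def of_nat_eq_iff_cong_CHAR CHAR_eq cong_def)
  hence "card ((of_nat :: nat \<Rightarrow> 'a) ` {..<p}) = p"
    by (simp add: card_image)
  moreover show sub: "of_nat ` {..<p} \<subseteq> {x :: 'a. x ^ p = x}"
    by (auto simp: of_nat_power_prime)
  ultimately show "card ((of_nat :: nat \<Rightarrow> 'a) ` {..<p}) = card {x :: 'a. x ^ p = x}"
    using le card_mono[OF _ sub] by simp
qed simp

text \<open>Frobenius permutes the conjugates in the trace cyclically, the last one returning to x
  because x^q = x.\<close>

lemma field_trace_power: "field_trace p r x ^ p = (field_trace p r x :: 'a)"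
proof -
  have "field_trace p r x ^ p = (\<Sum>i<r. (x ^ (p ^ i)) ^ p)"
    unfolding field_trace_def using prime_p
    by (intro freshmans_dream_sum) (simp_all add: CHAR_eq)
  also have "\<dots> = (\<Sum>i<r. x ^ (p ^ Suc i))"
    by (simp add: mult.commute flip: power_mult)
  also have "\<dots> + x ^ (p ^ 0) = (\<Sum>i<Suc r. x ^ (p ^ i))"
    by (subst sum.lessThan_Suc_shift) (simp add: add.commute)
  also have "\<dots> = field_trace p r x + x ^ CARD('a)"
    by (simp add: field_trace_def card)
  finally show ?thesis
    by (simp add: finite_field_power_card_eq_same)
qed

text \<open>As \<open>\<zeta> ^ p = 1\<close>, any natural representative of the trace may serve as
  exponent. This frees all later arguments from the description operator and its bound.\<close>

lemma additive_char_eq: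
  assumes "of_nat k = field_trace p r (x :: 'a)"
  shows "additive_char p r \<zeta> x = \<zeta> ^ k"
proof -
  have p0: "p > 0" and \<zeta>p: "\<zeta> ^ p = 1"
    using prime_p \<zeta> prime_gt_0_nat by (auto simp: primitive_root_unity_def)
  have "(THE k. k < p \<and> of_nat k = field_trace p r x) = k mod p"
    using p0 assms by (intro the_equality)
      (auto simp flip: assms simp: of_nat_eq_iff_cong_CHAR CHAR_eq cong_def)
  moreover have "\<zeta> ^ k = \<zeta> ^ (p * (k div p) + k mod p)"
    by simp
  hence "\<zeta> ^ k = \<zeta> ^ (k mod p)"
    unfolding power_add power_mult \<zeta>p by simp
  ultimately show ?thesis
    by (simp add: additive_char_def)
qed

lemma field_trace_of_nat: obtains k where "k < p" "of_nat k = field_trace p r (x :: 'a)"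
proof -
  have "field_trace p r x \<in> of_nat ` {..<p}"
    using field_trace_power[of x] by (simp flip: prime_field_eq)
  thus ?thesis
    using that by auto
qed

lemma additive_char_add:
  "additive_char p r \<zeta> (x + y :: 'a) = additive_char p r \<zeta> x * additive_char p r \<zeta> y"
proof -
  obtain k where k: "of_nat k = field_trace p r x"
    using field_trace_of_nat by blast
  obtain l where l: "of_nat l = field_trace p r y"
    using field_trace_of_nat by blast
  have "of_nat (k + l) = field_trace p r (x + y)"
    by (simp add: k l field_trace_add)
  thus ?thesis
    using additive_char_eq[OF k] additive_char_eq[OF l] additive_char_eq[of "k + l" "x + y"]
    by (simp add: power_add)
qed

lemma additive_char_0 [simp]: "additive_char p r \<zeta> (0 :: 'a) = 1"
proof -
  have "field_trace p r (0 :: 'a) = 0"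
    using prime_gt_0_nat[OF prime_p] by (simp add: field_trace_def power_0_left)
  thus ?thesis
    using additive_char_eq[of 0 0] by simp
qed

text \<open>The trace is a nonzero polynomial of degree at most p^(r - 1) < q, hence it cannot
  vanish on the whole field. A nonzero trace has a representative strictly between 0 and p, where
  \<zeta> is primitive.\<close>

lemma additive_char_nontrivial: "\<exists>x :: 'a. additive_char p r \<zeta> x \<noteq> 1"
proof -
  have p1: "p > 1"
    using prime_p prime_gt_1_nat by blast
  define f :: "'a poly" where "f = (\<Sum>i<r. monom 1 (p ^ i))"
  have "coeff f (p ^ 0) = (\<Sum>i<r. if i = 0 then 1 else 0)"
    unfolding f_def coeff_sum coeff_monom using p1 by (intro sum.cong) auto
  hence "f \<noteq> 0"
    using exponent_pos by auto
  have "degree f \<le> p ^ (r - 1)"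
    unfolding f_def
  proof (intro degree_sum_le)
    fix i assume "i \<in> {..<r}"
    hence "p ^ i \<le> p ^ (r - 1)"
      using p1 by (intro power_increasing) auto
    thus "degree (monom (1::'a) (p ^ i)) \<le> p ^ (r - 1)"
      by (simp add: degree_monom_eq)
  qed simp
  also have "\<dots> < CARD('a)"
    unfolding card using p1 exponent_pos by (intro power_strict_increasing) auto
  finally have "card {x. poly f x = 0} \<noteq> CARD('a)"
    using card_poly_roots_bound[OF \<open>f \<noteq> 0\<close>] by linarith
  hence "{x. poly f x = 0} \<noteq> UNIV"
    by auto
  moreover have "poly f x = field_trace p r x" for x
    by (simp add: f_def field_trace_def poly_sum poly_monom)
  ultimately obtain x :: 'a where x: "field_trace p r x \<noteq> 0"
    by auto
  obtain k where k: "k < p" "of_nat k = field_trace p r x"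
    using field_trace_of_nat by blast
  hence "k > 0"
    using x by (cases k) auto
  hence "\<zeta> ^ k \<noteq> 1"
    using k(1) \<zeta> by (auto simp: primitive_root_unity_def)
  thus ?thesis
    using additive_char_eq[OF k(2)] by metis
qed

lemma sum_additive_char: "(\<Sum>x\<in>UNIV. additive_char p r \<zeta> (x :: 'a)) = 0"
proof -
  obtain a :: 'a where a: "additive_char p r \<zeta> a \<noteq> 1"
    using additive_char_nontrivial by blast
  have "(\<Sum>x\<in>UNIV. additive_char p r \<zeta> (x :: 'a)) = (\<Sum>x\<in>UNIV. additive_char p r \<zeta> (1 * x + a))"
    by (rule sum_affine [symmetric]) simp
  also have "\<dots> = additive_char p r \<zeta> a * (\<Sum>x\<in>UNIV. additive_char p r \<zeta> (x :: 'a))"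
    by (simp add: additive_char_add sum_distrib_left mult.commute)
  finally show ?thesis
    using a by simp
qed

lemma cnj_additive_char: "cnj (additive_char p r \<zeta> (x :: 'a)) = additive_char p r \<zeta> (- x)"
proof -
  obtain k where k: "of_nat k = field_trace p r x"
    using field_trace_of_nat by blast
  have "norm \<zeta> ^ p = 1 ^ p"
    using \<zeta> by (simp add: primitive_root_unity_def flip: norm_power)
  hence "norm \<zeta> = 1"
    using prime_p prime_gt_0_nat power_eq_imp_eq_base[of "norm \<zeta>" p 1] by simp
  hence "norm (additive_char p r \<zeta> x) = 1"
    by (simp add: additive_char_eq[OF k] norm_power)
  hence "additive_char p r \<zeta> x * cnj (additive_char p r \<zeta> x) = 1"
    by (simp flip: complex_norm_square)
  moreover have "additive_char p r \<zeta> x * additive_char p r \<zeta> (- x) = 1"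
    by (simp flip: additive_char_add)
  ultimately show ?thesis
    by (metis mult_cancel_left mult_zero_left zero_neq_one)
qed

end

section \<open>Jacobi sums and products of Gauss sums\<close>

definition jacobi_sum :: "('a::finite_field \<Rightarrow> complex) \<Rightarrow> ('a \<Rightarrow> complex) \<Rightarrow> complex" where
  "jacobi_sum \<chi> \<psi> = (\<Sum>x\<in>UNIV. \<chi> x * \<psi> (1 - x))"

text \<open>The map x \<mapsto> x / (1 - x) takes every value except -1, so the sum is a complete
  character sum with one term missing.\<close>

lemma jacobi_sum_inverse:
  assumes \<chi>: "mult_char \<chi>" "\<chi> \<noteq> trivial_char"
  shows "jacobi_sum \<chi> (inverse \<chi>) = - \<chi> (-1)"
proof -
  have "jacobi_sum \<chi> (inverse \<chi>) = (\<Sum>x\<in>UNIV - {1}. \<chi> (x / (1 - x)))"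
    unfolding jacobi_sum_def using \<chi>(1)
    by (intro sum.mono_neutral_cong_right) (auto simp: mult_char_divide divide_inverse[of "\<chi> _"])
  also have "\<dots> = (\<Sum>w\<in>UNIV - {-1}. \<chi> w)"
  proof (rule sum.reindex_bij_witness[of _ "\<lambda>w. w / (1 + w)" "\<lambda>x. x / (1 - x)"])
    fix w :: 'a assume "w \<in> UNIV - {-1}"
    hence w: "1 + w \<noteq> 0"
      by (auto simp: add_eq_0_iff)
    thus "w / (1 + w) / (1 - w / (1 + w)) = w"
      by (simp add: field_simps)
    show "w / (1 + w) \<in> UNIV - {1}"
      using w by (simp add: divide_eq_eq)
  next
    fix x :: 'a assume "x \<in> UNIV - {1}"
    hence x: "1 - x \<noteq> 0"
      by auto
    thus "x / (1 - x) / (1 + x / (1 - x)) = x"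
      by (simp add: field_simps)
    show "x / (1 - x) \<in> UNIV - {-1}"
      using x by (auto simp: divide_eq_eq)
  qed auto
  also have "\<dots> = - \<chi> (-1)"
    using sum.remove[of UNIV "-1" \<chi>] sum_mult_char[OF \<chi>] by (simp add: add_eq_0_iff)
  finally show ?thesis .
qed

context
  fixes p r :: nat and \<zeta> :: complex
  assumes prime_p: "prime p" and card: "CARD('a::finite_field) = p ^ r"
    and \<zeta>: "primitive_root_unity p \<zeta>"
begin

text \<open>The product is collected by s = x + y. Scaling x by s turns a fibre with s \<noteq> 0
  into the Jacobi sum. The fibre s = 0 gives the last summand, which vanishes unless \<chi>\<psi> is
  trivial, so one formula serves both cases.\<close>

lemma gauss_sum_mult_general:
  fixes \<chi> \<psi> :: "'a \<Rightarrow> complex"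
  assumes "mult_char \<chi>" "mult_char \<psi>"
  shows "gauss_sum p r \<zeta> \<chi> * gauss_sum p r \<zeta> \<psi> =
    jacobi_sum \<chi> \<psi> * gauss_sum p r \<zeta> (\<chi> * \<psi>) + \<psi> (-1) * (\<Sum>x\<in>UNIV. (\<chi> * \<psi>) x)"
proof -
  let ?\<theta> = "additive_char p r \<zeta> :: 'a \<Rightarrow> complex"
  have inner: "(\<Sum>x\<in>UNIV. \<chi> x * \<psi> (s - x)) = jacobi_sum \<chi> \<psi> * (\<chi> * \<psi>) s +
      (if s = 0 then \<psi> (-1) * (\<Sum>x\<in>UNIV. (\<chi> * \<psi>) x) else 0)" for s
  proof (cases "s = 0")
    case True
    hence "\<chi> x * \<psi> (s - x) = \<psi> (-1) * (\<chi> * \<psi>) x" for x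
      using mult_char_minus[OF assms(2), of x] by simp
    moreover have "(\<chi> * \<psi>) s = 0"
      using True assms by simp
    ultimately show ?thesis
      using True by (simp only: sum_distrib_left if_True) simp
  next
    case False
    have "(\<Sum>x\<in>UNIV. \<chi> x * \<psi> (s - x)) = (\<Sum>x\<in>UNIV. \<chi> (s * x + 0) * \<psi> (s - (s * x + 0)))"
      using False by (rule sum_affine[of _ "\<lambda>x. \<chi> x * \<psi> (s - x)", symmetric])
    also have "\<dots> = (\<Sum>x\<in>UNIV. \<chi> x * \<psi> (1 - x) * (\<chi> s * \<psi> s))"
    proof (rule sum.cong)
      fix x
      have "\<psi> (s - s * x) = \<psi> s * \<psi> (1 - x)"
        using assms(2) by (simp flip: mult_char_mult add: algebra_simps)
      thus "\<chi> (s * x + 0) * \<psi> (s - (s * x + 0)) = \<chi> x * \<psi> (1 - x) * (\<chi> s * \<psi> s)"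
        using assms(1) by (simp add: mult_char_mult)
    qed simp
    finally show ?thesis
      using False by (simp add: jacobi_sum_def sum_distrib_right)
  qed
  have "gauss_sum p r \<zeta> \<chi> * gauss_sum p r \<zeta> \<psi> =
      (\<Sum>x\<in>UNIV. \<Sum>y\<in>UNIV. \<chi> x * \<psi> y * ?\<theta> (x + y))"
    unfolding gauss_sum_def sum_product
    by (simp add: additive_char_add[OF prime_p card \<zeta>] mult_ac)
  also have "\<dots> = (\<Sum>x\<in>UNIV. \<Sum>s\<in>UNIV. \<chi> x * \<psi> (s - x) * ?\<theta> s)"
  proof (rule sum.cong)
    fix x
    show "(\<Sum>y\<in>UNIV. \<chi> x * \<psi> y * ?\<theta> (x + y)) = (\<Sum>s\<in>UNIV. \<chi> x * \<psi> (s - x) * ?\<theta> s)"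
      by (rule sum.reindex_bij_witness[of _ "\<lambda>s. s - x" "\<lambda>y. x + y"]) auto
  qed simp
  also have "\<dots> = (\<Sum>s\<in>UNIV. (\<Sum>x\<in>UNIV. \<chi> x * \<psi> (s - x)) * ?\<theta> s)"
    by (subst sum.swap) (simp add: sum_distrib_right)
  also have "\<dots> = (\<Sum>s\<in>UNIV. jacobi_sum \<chi> \<psi> * ((\<chi> * \<psi>) s * ?\<theta> s) +
      (if s = 0 then \<psi> (-1) * (\<Sum>x\<in>UNIV. (\<chi> * \<psi>) x) else 0))"
    unfolding inner using additive_char_0[OF prime_p card \<zeta>]
    by (intro sum.cong) (auto simp: algebra_simps)
  finally show ?thesis
    by (simp add: sum.distrib gauss_sum_def sum_distrib_left)
qed

lemma gauss_sum_mult: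
  fixes \<chi> \<psi> :: "'a \<Rightarrow> complex"
  assumes "mult_char \<chi>" "mult_char \<psi>" "\<chi> * \<psi> \<noteq> trivial_char"
  shows "gauss_sum p r \<zeta> \<chi> * gauss_sum p r \<zeta> \<psi> = jacobi_sum \<chi> \<psi> * gauss_sum p r \<zeta> (\<chi> * \<psi>)"
  using gauss_sum_mult_general[OF assms(1,2)] sum_mult_char[of "\<chi> * \<psi>"] assms
  by (simp add: mult_char_times)

lemma gauss_sum_trivial: "gauss_sum p r \<zeta> (trivial_char :: 'a \<Rightarrow> complex) = -1"
proof -
  have "gauss_sum p r \<zeta> (trivial_char :: 'a \<Rightarrow> complex) =
      (\<Sum>x\<in>UNIV - {0::'a}. additive_char p r \<zeta> x)"
    unfolding gauss_sum_def by (intro sum.mono_neutral_cong_right) (auto simp: trivial_char_def)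
  thus ?thesis
    using sum.remove[of UNIV "0::'a" "additive_char p r \<zeta>"] sum_additive_char[OF prime_p card \<zeta>]
      additive_char_0[OF prime_p card \<zeta>]
    by (simp add: add_eq_0_iff)
qed

lemma gauss_sum_inverse:
  fixes \<chi> :: "'a \<Rightarrow> complex"
  assumes "mult_char \<chi>" "\<chi> \<noteq> trivial_char"
  shows "gauss_sum p r \<zeta> \<chi> * gauss_sum p r \<zeta> (inverse \<chi>) = \<chi> (-1) * of_nat CARD('a)"
proof -
  have "\<chi> * inverse \<chi> = trivial_char"
    using assms by (auto simp: fun_eq_iff trivial_char_def)
  moreover have "inverse (\<chi> (-1)) = \<chi> (-1)"
    using assms by (simp flip: mult_char_inverse)
  ultimately show ?thesis
    using gauss_sum_mult_general[of \<chi> "inverse \<chi>"] assms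
    by (simp add: mult_char_inverse_fun jacobi_sum_inverse gauss_sum_trivial sum_trivial_char algebra_simps)
qed

lemma cnj_gauss_sum:
  fixes \<chi> :: "'a \<Rightarrow> complex"
  assumes "mult_char \<chi>"
  shows "cnj (gauss_sum p r \<zeta> \<chi>) = \<chi> (-1) * gauss_sum p r \<zeta> (inverse \<chi>)"
proof -
  have inv: "inverse (\<chi> (-1)) = \<chi> (-1)"
    using assms by (simp flip: mult_char_inverse)
  have "cnj (gauss_sum p r \<zeta> \<chi>) = (\<Sum>x\<in>UNIV. inverse (\<chi> x) * additive_char p r \<zeta> (- x))"
    using assms by (simp add: gauss_sum_def cnj_mult_char cnj_additive_char[OF prime_p card \<zeta>])
  also have "\<dots> = (\<Sum>x\<in>UNIV. inverse (\<chi> (- x)) * additive_char p r \<zeta> x)"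
    by (rule sum.reindex_bij_witness[of _ uminus uminus]) auto
  also have "\<dots> = (\<Sum>x\<in>UNIV. \<chi> (-1) * (inverse (\<chi> x) * additive_char p r \<zeta> x))"
  proof (rule sum.cong)
    fix x
    show "inverse (\<chi> (- x)) * additive_char p r \<zeta> x =
        \<chi> (-1) * (inverse (\<chi> x) * additive_char p r \<zeta> x)"
      using mult_char_minus[OF assms, of x] inv by simp
  qed simp
  also have "\<dots> = \<chi> (-1) * gauss_sum p r \<zeta> (inverse \<chi>)"
    by (simp add: gauss_sum_def sum_distrib_left)
  finally show ?thesis .
qed

lemma gauss_sum_times_cnj:
  fixes \<chi> :: "'a \<Rightarrow> complex"
  assumes "mult_char \<chi>" "\<chi> \<noteq> trivial_char"
  shows "gauss_sum p r \<zeta> \<chi> * cnj (gauss_sum p r \<zeta> \<chi>) = of_nat CARD('a)"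
  using gauss_sum_inverse[OF assms] mult_char_neg1_square[OF assms(1)] assms
  by (simp add: cnj_gauss_sum algebra_simps)

end

section \<open>Reduction to cubic character sums\<close>

text \<open>Where the curve is smooth, this is minus the trace of Frobenius of y^2 = x^3 + 3n x^2 +
  n^2 (1 - n)^2. The discriminant of the cubic is -27 n^4 (1 - n)^2 (1 + n)^2, so for 3 \<noteq> 0
  the degenerate fibres are n = 0, 1 and -1.\<close>

definition cubic_char_sum :: "'a::finite_field \<Rightarrow> complex" where
  "cubic_char_sum n = (\<Sum>x\<in>UNIV. quadratic_char (x ^ 3 + 3 * n * x ^ 2 + n ^ 2 * (1 - n) ^ 2))"

context
  assumes odd_card: "odd CARD('a::finite_field)"
begin

lemma sum_quartic_to_cubic:
  fixes n :: 'a
  assumes n: "n \<noteq> 0"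
  shows "(\<Sum>k\<in>UNIV. quadratic_char ((k ^ 2 - 3 * n) ^ 2 - 8 * n * (1 - n) * k)) =
    cubic_char_sum n - 1 + (if n = 1 then of_nat CARD('a) else 0)"
proof -
  have two: "(2::'a) \<noteq> 0"
    using two_neq_0[OF odd_card] .
  hence four: "(4::'a) \<noteq> 0"
    using power_not_zero[of "2::'a" 2] by simp
  define Q where "Q k = (k ^ 2 - 3 * n) ^ 2 - 8 * n * (1 - n) * k" for k
  define D where "D x = n ^ 2 * (1 - n) ^ 2 - x * (x ^ 2 - 3 * n * x)" for x
  define L where "L x k = x * k ^ 2 + 2 * n * (1 - n) * k + x ^ 2 - 3 * n * x" for x k
  \<comment> \<open>The substitution z = 2x + k^2 - 3n turns z^2 = Q k into L x k = 0, whose discriminant as a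
    quadratic in k is 4 D x.\<close>
  have roots: "(\<Sum>z\<in>UNIV. if z ^ 2 = d then 1 else 0) = 1 + quadratic_char d" for d :: 'a
    using sum_over_squares[OF odd_card, of "\<lambda>v. if v = d then 1 else 0"] by (simp add: if_distrib[of "(*) _"] cong: if_cong)
  have "(\<Sum>k\<in>UNIV. 1 + quadratic_char (Q k)) =
      (\<Sum>k\<in>UNIV. \<Sum>z\<in>UNIV. if z ^ 2 = Q k then 1 else 0)"
    by (simp only: roots)
  also have "\<dots> = (\<Sum>k\<in>UNIV. \<Sum>x\<in>UNIV. if L x k = 0 then 1 else 0)"
  proof (rule sum.cong)
    fix k
    have "(2 * x + (k ^ 2 - 3 * n)) ^ 2 = Q k \<longleftrightarrow> L x k = 0" for x
    proof -
      have "(2 * x + (k ^ 2 - 3 * n)) ^ 2 - Q k = 4 * L x k"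
        by (simp add: Q_def L_def algebra_simps power2_eq_square)
      thus ?thesis
        using four by (metis eq_iff_diff_eq_0 mult_eq_0_iff)
    qed
    thus "(\<Sum>z\<in>UNIV. if z ^ 2 = Q k then 1 else 0) = (\<Sum>x\<in>UNIV. if L x k = 0 then 1 else (0::complex))"
      using sum_affine[OF two, of "\<lambda>z. if z ^ 2 = Q k then 1 else 0" "k ^ 2 - 3 * n"] by simp
  qed simp
  also have "\<dots> = (\<Sum>x\<in>UNIV. \<Sum>k\<in>UNIV. if L x k = 0 then 1 else 0)"
    by (rule sum.swap)
  also have "\<dots> = (\<Sum>k\<in>UNIV. if L 0 k = 0 then 1 else 0) +
      (\<Sum>x\<in>UNIV - {0}. \<Sum>k\<in>UNIV. if L x k = 0 then 1 else 0)"
    by (rule sum.remove) auto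
  \<comment> \<open>At x = 0 the equation is only linear in k, namely 2n (1 - n) k = 0. It holds
    identically for n = 1, and this is the origin of the extra summand q.\<close>
  also have "(\<Sum>k\<in>UNIV. if L 0 k = 0 then 1 else 0) = (if n = 1 then of_nat CARD('a) else (1::complex))"
    using n two by (auto simp: L_def)
  also have "(\<Sum>x\<in>UNIV - {0}. \<Sum>k\<in>UNIV. if L x k = 0 then 1 else 0) =
      (\<Sum>x\<in>UNIV - {0}. 1 + quadratic_char (D x))"
  proof (rule sum.cong)
    fix x :: 'a assume "x \<in> UNIV - {0}"
    hence x: "x \<noteq> 0"
      by simp
    have "(x * k + n * (1 - n)) ^ 2 = D x \<longleftrightarrow> L x k = 0" for k
    proof -
      have "(x * k + n * (1 - n)) ^ 2 - D x = x * L x k"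
        by (simp add: D_def L_def algebra_simps power2_eq_square)
      thus ?thesis
        using x by (metis eq_iff_diff_eq_0 mult_eq_0_iff)
    qed
    thus "(\<Sum>k\<in>UNIV. if L x k = 0 then 1 else 0) = 1 + quadratic_char (D x)"
      using sum_affine[OF x, of "\<lambda>z. if z ^ 2 = D x then 1 else 0" "n * (1 - n)"] roots[of "D x"] by simp
  qed simp
  also have "\<dots> = (\<Sum>x\<in>UNIV. 1 + quadratic_char (D x)) - (1 + quadratic_char (D 0))"
    by (subst sum.remove[of UNIV 0]) auto
  \<comment> \<open>\<open>D 0\<close> is the square of n (1 - n), which is zero exactly when n =
    1.\<close>
  also have "1 + quadratic_char (D 0) = (if n = 1 then 1 else 2)"
    using n by (simp add: D_def flip: power_mult_distrib)
  also have "(\<Sum>x\<in>UNIV. 1 + quadratic_char (D x)) = of_nat CARD('a) + cubic_char_sum n"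
  proof -
    have "(\<Sum>x\<in>UNIV. quadratic_char (D x)) = (\<Sum>x\<in>UNIV. quadratic_char (D (- x)))"
      by (rule sum.reindex_bij_witness[of _ uminus uminus]) auto
    also have "\<dots> = cubic_char_sum n"
      unfolding cubic_char_sum_def
      by (intro sum.cong arg_cong[of _ _ quadratic_char]) (auto simp: D_def algebra_simps power2_eq_square power3_eq_cube)
    finally show ?thesis
      by (simp add: sum.distrib)
  qed
  finally show ?thesis
    by (simp add: sum.distrib Q_def split: if_splits)
qed

text \<open>For n = 1 and n = -1 the cubic has the double root 1 - n, and \<phi> sees only the
  remaining linear factor. Its full sum is 0, and its value 3 at the double root has to be
  removed.\<close>

lemma cubic_char_sum_degenerate:
  fixes n :: 'a
  assumes n: "n ^ 2 = 1"
  shows "cubic_char_sum n = - quadratic_char (3 :: 'a)"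
proof -
  have "x ^ 3 + 3 * n * x ^ 2 + n ^ 2 * (1 - n) ^ 2 = (x + n - 1) ^ 2 * (x + (n + 2))" for x
  proof -
    \<comment> \<open>The factorization holds only modulo n^2 - 1, so the identity carries an
      explicit multiple of n^2 - 1.\<close>
    have "x ^ 3 + 3 * n * x ^ 2 + n ^ 2 * (1 - n) ^ 2 =
        (x + n - 1) ^ 2 * (x + (n + 2)) + (n ^ 2 - 1) * ((n - 1) * (n - 2) - 3 * x)"
      by (simp add: algebra_simps power2_eq_square power3_eq_cube)
    thus ?thesis
      using n by simp
  qed
  hence "cubic_char_sum n = (\<Sum>x\<in>UNIV. quadratic_char ((x + n - 1) ^ 2 * (x + (n + 2))))"
    by (simp only: cubic_char_sum_def)
  also have "\<dots> = (\<Sum>x\<in>UNIV - {1 - n}. quadratic_char (x + (n + 2)))"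
  proof (intro sum.mono_neutral_cong_right ballI)
    fix x :: 'a assume "x \<in> UNIV - {1 - n}"
    hence "x + n - 1 \<noteq> 0"
      by (auto simp: algebra_simps)
    thus "quadratic_char ((x + n - 1) ^ 2 * (x + (n + 2))) = quadratic_char (x + (n + 2))"
      by (rule quadratic_char_mult_square[OF odd_card])
  qed auto
  also have "\<dots> = (\<Sum>x\<in>UNIV. quadratic_char (x + (n + 2))) - quadratic_char (1 - n + (n + 2))"
    by (subst sum.remove[of UNIV "1 - n"]) auto
  finally show ?thesis
    by (simp add: sum_quadratic_char_shift[OF odd_card])
qed

text \<open>This quartic has the rational root m = n. Sending it to infinity by x = 1 / (m - n)
  leaves a cubic up to the square factor (m - n)^4. The value x = 0, which corresponds to m =
  infinity, accounts for the -1.\<close>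

lemma sum_factored_quartic_to_cubic:
  fixes n :: 'a
  assumes n: "n \<noteq> 0" and three: "(3::'a) \<noteq> 0"
  shows "(\<Sum>m\<in>UNIV. quadratic_char ((m - n) * (m ^ 3 - n))) = cubic_char_sum n - 1"
proof -
  define c where "c = n ^ 3 - n"
  define f where "f x = c * x ^ 3 + 3 * n ^ 2 * x ^ 2 + 3 * n * x + 1" for x
  have "(\<Sum>m\<in>UNIV. quadratic_char ((m - n) * (m ^ 3 - n))) =
      (\<Sum>m\<in>UNIV - {n}. quadratic_char ((m - n) * (m ^ 3 - n)))"
    by (intro sum.mono_neutral_right) auto
  also have "\<dots> = (\<Sum>x\<in>UNIV - {0}. quadratic_char (f x))"
  proof (rule sum.reindex_bij_witness[of _ "\<lambda>x. n + 1 / x" "\<lambda>m. 1 / (m - n)"])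
    fix m assume "m \<in> UNIV - {n}"
    hence m: "m - n \<noteq> 0"
      by simp
    have "(m - n) * (m ^ 3 - n) = ((m - n) ^ 2) ^ 2 * f (1 / (m - n))"
    proof -
      define d where "d = m - n"
      have "d \<noteq> 0" "m = n + d"
        using m by (auto simp: d_def)
      thus ?thesis
        by (simp add: f_def c_def field_simps power2_eq_square power3_eq_cube)
    qed
    thus "quadratic_char (f (1 / (m - n))) = quadratic_char ((m - n) * (m ^ 3 - n))"
      using m quadratic_char_mult_square[OF odd_card, of "(m - n) ^ 2" "f (1 / (m - n))"] by simp
  qed auto
  also have "\<dots> = (\<Sum>x\<in>UNIV. quadratic_char (f x)) - 1"
    by (subst sum.remove[of UNIV 0]) (auto simp: f_def)
  also have "(\<Sum>x\<in>UNIV. quadratic_char (f x)) = cubic_char_sum n"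
  proof (cases "c = 0")
    case True
    hence "n * (n ^ 2 - 1) = 0"
      by (simp add: c_def algebra_simps power2_eq_square power3_eq_cube)
    hence n2: "n ^ 2 = 1"
      using n by simp
    \<comment> \<open>For n = 1 or n = -1 the leading coefficient c vanishes and a quadratic with
      discriminant 9 - 12 = -3 remains.\<close>
    have "(3 * n) ^ 2 - 4 * 3 * 1 \<noteq> (0::'a)"
      using three n2 by (simp add: power_mult_distrib)
    hence "(\<Sum>x\<in>UNIV. quadratic_char (3 * x ^ 2 + 3 * n * x + 1)) = - quadratic_char (3 :: 'a)"
      using three by (intro sum_quadratic_char_quadratic[OF odd_card])
    thus ?thesis
      using n2 by (simp add: f_def True cubic_char_sum_degenerate)
  next
    case False
    define g where "g x = x ^ 3 + 3 * n * x ^ 2 + n ^ 2 * (1 - n) ^ 2" for x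
    \<comment> \<open>Multiplying by c^2 makes the cubic monic in c x, and the shift by n^2 - n
      removes its linear term, which gives the same Weierstrass form as for the other
      quartic.\<close>
    have "c ^ 2 * f x = g (c * x + (n ^ 2 - n))" for x
      unfolding f_def g_def c_def by (simp add: algebra_simps power2_eq_square power3_eq_cube)
    hence "quadratic_char (f x) = quadratic_char (g (c * x + (n ^ 2 - n)))" for x
      using quadratic_char_mult_square[OF odd_card False, of "f x"] by simp
    thus ?thesis
      using sum_affine[OF False, of "\<lambda>x. quadratic_char (g x)" "n ^ 2 - n"]
      by (simp add: cubic_char_sum_def g_def)
  qed
  finally show ?thesis .
qed

section \<open>Summation over n against a character\<close>

context
  fixes \<chi> :: "'a \<Rightarrow> complex"
  assumes \<chi>: "mult_char \<chi>" "\<chi> \<noteq> trivial_char" "\<chi> (-1) = 1" and three: "(3::'a) \<noteq> 0"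
begin

lemma sum_mult_char_Diff_singleton: "(\<Sum>n\<in>UNIV - {a}. \<chi> n) = - \<chi> a"
  using sum.remove[of UNIV a \<chi>] sum_mult_char[OF \<chi>(1,2)] by (simp add: add_eq_0_iff)

text \<open>
  For fixed k, the new variable n = k (Y - k) / (1 + Y) is a Moebius function of Y unless k is 0
  or -1, and the term \<open>\<chi> k\<close> is the contribution of Y = infinity.
\<close>

lemma mobius_substitution:
  fixes k :: 'a
  shows "(\<Sum>Y\<in>UNIV. \<chi> (k * (Y - k) / (1 + Y)) * quadratic_char (Y ^ 2 + 8 * k - 8 * Y)) =
    (\<Sum>n\<in>UNIV. \<chi> n * quadratic_char ((k ^ 2 - 3 * n) ^ 2 - 8 * n * (1 - n) * k)) - \<chi> k"
proof -
  have two: "(2::'a) \<noteq> 0"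
    using two_neq_0[OF odd_card] .
  consider "k = 0" | "k = -1" | "k \<noteq> 0" "k \<noteq> -1"
    by blast
  thus ?thesis
  proof cases
    case 1
    \<comment> \<open>For k = 0 the quartic is the square of 3n, so both sides vanish. The
      invertibility of 3 enters here.\<close>
    have "\<chi> n * quadratic_char (9 * n ^ 2) = \<chi> n" for n
      using three \<chi>(1) quadratic_char_square[of "3 * n"] by (auto simp: power_mult_distrib)
    hence "(\<Sum>n\<in>UNIV. \<chi> n * quadratic_char (9 * n ^ 2)) = 0"
      by (simp only: sum_mult_char[OF \<chi>(1,2)])
    thus ?thesis
      using \<chi>(1) by (simp add: 1 power_mult_distrib)
  next
    case 2
    \<comment> \<open>For k = -1 the new variable is constantly -1 and nothing can be substituted,
      so both sides are computed and equal -2. The number 2^5 * 3 = 96 is the discriminant of Y^2 -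
      8Y - 8.\<close>
    have "(2::'a) ^ 5 * 3 \<noteq> 0"
      by (intro no_zero_divisors power_not_zero two three)
    hence disc: "(-8) ^ 2 - 4 * 1 * (-8) \<noteq> (0 :: 'a)"
      by simp
    have "(\<Sum>Y\<in>UNIV. \<chi> (k * (Y - k) / (1 + Y)) * quadratic_char (Y ^ 2 + 8 * k - 8 * Y)) =
        (\<Sum>Y\<in>UNIV - {-1 :: 'a}. quadratic_char (1 * Y ^ 2 + (-8) * Y + (-8)))"
    proof (intro sum.mono_neutral_cong_right ballI)
      fix Y :: 'a assume "Y \<in> UNIV - {-1}"
      hence "1 + Y \<noteq> 0"
        by (auto simp: add_eq_0_iff)
      hence "k * (Y - k) / (1 + Y) = -1"
        by (simp add: 2 field_simps)
      thus "\<chi> (k * (Y - k) / (1 + Y)) * quadratic_char (Y ^ 2 + 8 * k - 8 * Y) =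
          quadratic_char (1 * Y ^ 2 + (-8) * Y + (-8))"
        using \<chi>(3) by (simp add: 2 algebra_simps)
    qed (use \<chi> in auto)
    also have "\<dots> = (\<Sum>Y\<in>UNIV. quadratic_char (1 * Y ^ 2 + (-8) * Y + (-8) :: 'a)) -
        quadratic_char (1 * (-1) ^ 2 + (-8) * (-1) + (-8) :: 'a)"
      by (subst sum.remove[of UNIV "-1"]) auto
    also have "(\<Sum>Y\<in>UNIV. quadratic_char (1 * Y ^ 2 + (-8) * Y + (-8) :: 'a)) = - quadratic_char (1::'a)"
      using disc by (intro sum_quadratic_char_quadratic[OF odd_card]) auto
    finally have lhs: "(\<Sum>Y\<in>UNIV. \<chi> (k * (Y - k) / (1 + Y)) * quadratic_char (Y ^ 2 + 8 * k - 8 * Y)) = -2"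
      by simp
    have "(\<Sum>n\<in>UNIV. \<chi> n * quadratic_char ((k ^ 2 - 3 * n) ^ 2 - 8 * n * (1 - n) * k)) =
        (\<Sum>n\<in>UNIV - {-1}. \<chi> n)"
    proof (intro sum.mono_neutral_cong_right ballI)
      have eq: "(k ^ 2 - 3 * n) ^ 2 - 8 * n * (1 - n) * k = (1 + n) ^ 2" for n
        unfolding 2 by (simp add: algebra_simps power2_eq_square)
      show "\<chi> n * quadratic_char ((k ^ 2 - 3 * n) ^ 2 - 8 * n * (1 - n) * k) = \<chi> n"
        if "n \<in> UNIV - {-1}" for n
        using that unfolding eq by (auto simp: add_eq_0_iff)
      show "\<chi> n * quadratic_char ((k ^ 2 - 3 * n) ^ 2 - 8 * n * (1 - n) * k) = 0"
        if "n \<in> UNIV - (UNIV - {-1})" for n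
        using that unfolding eq by auto
    qed auto
    thus ?thesis
      unfolding lhs using \<chi> by (simp add: sum_mult_char_Diff_singleton 2)
  next
    case 3
    hence k1: "1 + k \<noteq> 0"
      by (auto simp: add_eq_0_iff)
    have "(\<Sum>Y\<in>UNIV. \<chi> (k * (Y - k) / (1 + Y)) * quadratic_char (Y ^ 2 + 8 * k - 8 * Y)) =
        (\<Sum>Y\<in>UNIV - {-1}. \<chi> (k * (Y - k) / (1 + Y)) * quadratic_char (Y ^ 2 + 8 * k - 8 * Y))"
      using \<chi>(1) by (intro sum.mono_neutral_right) auto
    also have "\<dots> = (\<Sum>n\<in>UNIV - {k}. \<chi> n * quadratic_char ((k ^ 2 - 3 * n) ^ 2 - 8 * n * (1 - n) * k))"
    proof (rule sum.reindex_bij_witness[of _ "\<lambda>n. (n + k ^ 2) / (k - n)" "\<lambda>Y. k * (Y - k) / (1 + Y)"])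
      fix Y :: 'a assume "Y \<in> UNIV - {-1}"
      hence Y: "1 + Y \<noteq> 0"
        by (auto simp: add_eq_0_iff)
      define n where "n = k * (Y - k) / (1 + Y)"
      have kn: "(1 + Y) * (k - n) = k * (1 + k)"
        using Y by (simp add: n_def field_simps)
      hence kn0: "k - n \<noteq> 0"
        using 3 k1 by auto
      thus "k * (Y - k) / (1 + Y) \<in> UNIV - {k}"
        by (auto simp: n_def)
      have "n * (1 + Y) = k * (Y - k)"
        using Y by (simp add: n_def)
      hence Yn: "Y * (k - n) = n + k ^ 2"
        by (simp add: algebra_simps power2_eq_square)
      show "(k * (Y - k) / (1 + Y) + k ^ 2) / (k - k * (Y - k) / (1 + Y)) = Y"
        unfolding n_def [symmetric] using kn0 by (simp flip: Yn)
      \<comment> \<open>Clearing the denominator of Y = (n + k^2) / (k - n) by a square does not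
        change \<phi>. The coefficient 8 makes the part even in k equal to k^4 - 6n k^2 + 9n^2, the
        square of k^2 - 3n.\<close>
      have "(k - n) ^ 2 * (Y ^ 2 + 8 * k - 8 * Y) =
          (Y * (k - n)) ^ 2 + 8 * k * (k - n) ^ 2 - 8 * (Y * (k - n)) * (k - n)"
        by (simp add: algebra_simps power2_eq_square)
      also have "\<dots> = (k ^ 2 - 3 * n) ^ 2 - 8 * n * (1 - n) * k"
        unfolding Yn by (simp add: algebra_simps power2_eq_square)
      finally have qc: "quadratic_char ((k ^ 2 - 3 * n) ^ 2 - 8 * n * (1 - n) * k) =
          quadratic_char (Y ^ 2 + 8 * k - 8 * Y)"
        using quadratic_char_mult_square[OF odd_card kn0, of "Y ^ 2 + 8 * k - 8 * Y"] by simp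
      show "\<chi> (k * (Y - k) / (1 + Y)) * quadratic_char ((k ^ 2 - 3 * (k * (Y - k) / (1 + Y))) ^ 2 -
            8 * (k * (Y - k) / (1 + Y)) * (1 - k * (Y - k) / (1 + Y)) * k) =
          \<chi> (k * (Y - k) / (1 + Y)) * quadratic_char (Y ^ 2 + 8 * k - 8 * Y)"
        unfolding n_def [symmetric] qc ..
    next
      fix n assume "n \<in> UNIV - {k}"
      hence n: "k - n \<noteq> 0"
        by auto
      have eq: "1 + (n + k ^ 2) / (k - n) = k * (1 + k) / (k - n)"
        using n by (simp add: field_simps power2_eq_square)
      thus "(n + k ^ 2) / (k - n) \<in> UNIV - {-1}"
        using n 3 k1 by (auto simp: add_eq_0_iff)
      have "(n + k ^ 2) / (k - n) - k = n * (1 + k) / (k - n)"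
        using n by (simp add: field_simps power2_eq_square)
      thus "k * ((n + k ^ 2) / (k - n) - k) / (1 + (n + k ^ 2) / (k - n)) = n"
        unfolding eq using n 3 k1 by simp
    qed
    also have "\<dots> = (\<Sum>n\<in>UNIV. \<chi> n * quadratic_char ((k ^ 2 - 3 * n) ^ 2 - 8 * n * (1 - n) * k)) -
        \<chi> k * quadratic_char ((k ^ 2 - 3 * k) ^ 2 - 8 * k * (1 - k) * k)"
      by (subst sum.remove[of UNIV k]) auto
    \<comment> \<open>The value n = k, which no finite Y attains, makes the quartic a nonzero
      square, so the omitted term is \<open>\<chi> k\<close>.\<close>
    also have "(k ^ 2 - 3 * k) ^ 2 - 8 * k * (1 - k) * k = (k * (1 + k)) ^ 2"
      by (simp add: algebra_simps power2_eq_square)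
    finally show ?thesis
      using 3(1) k1 by (simp del: power_mult_distrib)
  qed
qed

text \<open>The corrections \<open>\<chi> k\<close> and -1 cancel after summation because a
  nontrivial character sums to 0. Only the excess q of the fibre n = 1 survives.\<close>

lemma double_sum_eq:
  "(\<Sum>k\<in>UNIV. \<Sum>Y\<in>UNIV. \<chi> (k * (Y - k) / (1 + Y)) * quadratic_char (Y ^ 2 + 8 * k - 8 * Y)) =
    of_nat CARD('a) + (\<Sum>n\<in>UNIV. \<chi> n * cubic_char_sum n)"
proof -
  have "(\<Sum>k\<in>UNIV. \<Sum>Y\<in>UNIV. \<chi> (k * (Y - k) / (1 + Y)) * quadratic_char (Y ^ 2 + 8 * k - 8 * Y)) =
    (\<Sum>k\<in>UNIV. \<Sum>n\<in>UNIV. \<chi> n * quadratic_char ((k ^ 2 - 3 * n) ^ 2 - 8 * n * (1 - n) * k))"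
    using \<chi> by (simp add: mobius_substitution sum_subtractf sum_mult_char)
  also have "\<dots> = (\<Sum>n\<in>UNIV. \<chi> n * (\<Sum>k\<in>UNIV. quadratic_char ((k ^ 2 - 3 * n) ^ 2 - 8 * n * (1 - n) * k)))"
    by (subst sum.swap) (simp add: sum_distrib_left)
  also have "\<dots> = (\<Sum>n\<in>UNIV. \<chi> n * cubic_char_sum n - \<chi> n + (if n = 1 then of_nat CARD('a) else 0))"
  proof (rule sum.cong)
    fix n
    show "\<chi> n * (\<Sum>k\<in>UNIV. quadratic_char ((k ^ 2 - 3 * n) ^ 2 - 8 * n * (1 - n) * k)) =
        \<chi> n * cubic_char_sum n - \<chi> n + (if n = 1 then of_nat CARD('a) else 0)"
    proof (cases "n = 0")
      case False
      show ?thesis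
        unfolding sum_quartic_to_cubic[OF False] using \<chi> by (simp add: algebra_simps)
    qed (use \<chi> in simp)
  qed simp
  finally show ?thesis
    using \<chi> by (simp add: sum.distrib sum_subtractf sum_mult_char)
qed

text \<open>The inverse map is v = (m - n) / (m^3 - n), whence \<phi>(v) = \<phi>((m - n)(m^3 - n)).
  The unreachable value n = m^3 belongs to v = infinity and costs \<chi>(m^3) in the untwisted part.
  The determinant of the map is m - m^3. If m^2 = 1, the map is constant with \<chi>(m) = 1, and the
  nearly complete sum of 1 + \<phi>(v) yields q.\<close>

lemma mobius_substitution_ratio:
  fixes m :: 'a
  shows "(\<Sum>v\<in>UNIV. (1 + quadratic_char v) * \<chi> (m * (m ^ 2 * v - 1) / (v - 1))) =
    (\<Sum>n\<in>UNIV. \<chi> n * quadratic_char ((m - n) * (m ^ 3 - n))) - (\<chi> ^ 3) m +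
      (if m ^ 2 = 1 then of_nat CARD('a) else 0)"
proof -
  consider "m = 0" | "m ^ 2 = 1" | "m \<noteq> 0" "m ^ 2 \<noteq> 1"
    by blast
  thus ?thesis
  proof cases
    case 1
    have "\<chi> n * quadratic_char (n * n) = \<chi> n" for n
      using \<chi>(1) quadratic_char_square[of n] by (simp add: power2_eq_square)
    hence "(\<Sum>n\<in>UNIV. \<chi> n * quadratic_char (n * n)) = 0"
      by (simp only: sum_mult_char[OF \<chi>(1,2)])
    thus ?thesis
      using \<chi>(1) by (simp add: 1 power_fun_apply)
  next
    case 2
    hence m: "m = 1 \<or> m = -1"
      by (simp add: power2_eq_1_iff)
    hence \<chi>m: "\<chi> m = 1" and m3: "m ^ 3 = m"
      using \<chi> by (auto simp: power3_eq_cube)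
    have "(\<Sum>v\<in>UNIV. (1 + quadratic_char v) * \<chi> (m * (m ^ 2 * v - 1) / (v - 1))) =
        (\<Sum>v\<in>UNIV - {1 :: 'a}. 1 + quadratic_char v)"
      using \<chi> by (intro sum.mono_neutral_cong_right) (auto simp: 2 \<chi>m)
    also have "\<dots> = (\<Sum>v\<in>UNIV. 1 + quadratic_char (v :: 'a)) - 2"
      by (subst sum.remove[of UNIV 1]) auto
    also have "\<dots> = of_nat CARD('a) - 2"
      by (simp add: sum.distrib sum_quadratic_char[OF odd_card])
    finally have lhs: "(\<Sum>v\<in>UNIV. (1 + quadratic_char v) * \<chi> (m * (m ^ 2 * v - 1) / (v - 1))) =
        of_nat CARD('a) - 2" .
    have "(\<Sum>n\<in>UNIV. \<chi> n * quadratic_char ((m - n) * (m ^ 3 - n))) = (\<Sum>n\<in>UNIV - {m}. \<chi> n)"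
      unfolding m3 power2_eq_square[symmetric]
      by (intro sum.mono_neutral_cong_right) auto
    thus ?thesis
      unfolding lhs by (simp add: sum_mult_char_Diff_singleton 2 \<chi>m power_fun_apply)
  next
    case 3
    have mm: "m ^ 3 - m \<noteq> 0"
    proof
      assume "m ^ 3 - m = 0"
      hence "m * (m ^ 2 - 1) = 0"
        by (simp add: algebra_simps power2_eq_square power3_eq_cube)
      thus False
        using 3 by simp
    qed
    have "(\<Sum>v\<in>UNIV. (1 + quadratic_char v) * \<chi> (m * (m ^ 2 * v - 1) / (v - 1))) =
        (\<Sum>v\<in>UNIV - {1}. (1 + quadratic_char v) * \<chi> (m * (m ^ 2 * v - 1) / (v - 1)))"
      using \<chi>(1) by (intro sum.mono_neutral_right) auto
    also have "\<dots> = (\<Sum>n\<in>UNIV - {m ^ 3}. \<chi> n + \<chi> n * quadratic_char ((m - n) * (m ^ 3 - n)))"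
    proof (rule sum.reindex_bij_witness[of _ "\<lambda>n. (m - n) / (m ^ 3 - n)" "\<lambda>v. m * (m ^ 2 * v - 1) / (v - 1)"])
      fix v assume "v \<in> UNIV - {1 :: 'a}"
      hence v: "v - 1 \<noteq> 0"
        by simp
      define n where "n = m * (m ^ 2 * v - 1) / (v - 1)"
      have "(v - 1) * (m ^ 3 - n) = m - m ^ 3"
        using v by (simp add: n_def field_simps power2_eq_square power3_eq_cube)
      hence n0: "m ^ 3 - n \<noteq> 0"
        using mm by auto
      thus "m * (m ^ 2 * v - 1) / (v - 1) \<in> UNIV - {m ^ 3}"
        by (auto simp: n_def)
      have "n * (v - 1) = m * (m ^ 2 * v - 1)"
        using v by (simp add: n_def)
      hence vn: "v * (m ^ 3 - n) = m - n"
        by (simp add: algebra_simps power2_eq_square power3_eq_cube)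
      show "(m - m * (m ^ 2 * v - 1) / (v - 1)) / (m ^ 3 - m * (m ^ 2 * v - 1) / (v - 1)) = v"
        unfolding n_def [symmetric] using n0 vn by (simp add: field_simps)
      have "(m - n) * (m ^ 3 - n) = (m ^ 3 - n) ^ 2 * v"
        by (simp flip: vn add: power2_eq_square)
      hence qc: "quadratic_char ((m - n) * (m ^ 3 - n)) = quadratic_char v"
        by (simp only: quadratic_char_mult_square[OF odd_card n0])
      show "\<chi> (m * (m ^ 2 * v - 1) / (v - 1)) + \<chi> (m * (m ^ 2 * v - 1) / (v - 1)) *
          quadratic_char ((m - m * (m ^ 2 * v - 1) / (v - 1)) * (m ^ 3 - m * (m ^ 2 * v - 1) / (v - 1))) =
          (1 + quadratic_char v) * \<chi> (m * (m ^ 2 * v - 1) / (v - 1))"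
        unfolding n_def [symmetric] qc by (simp add: algebra_simps)
    next
      fix n assume "n \<in> UNIV - {m ^ 3}"
      hence n: "m ^ 3 - n \<noteq> 0"
        by auto
      have eq: "(m - n) / (m ^ 3 - n) - 1 = (m - m ^ 3) / (m ^ 3 - n)"
        using n by (simp add: field_simps)
      thus "(m - n) / (m ^ 3 - n) \<in> UNIV - {1}"
        using mm n by auto
      have "m * (m ^ 2 * ((m - n) / (m ^ 3 - n)) - 1) = n * (m - m ^ 3) / (m ^ 3 - n)"
        using n by (simp add: field_simps power2_eq_square power3_eq_cube)
      thus "m * (m ^ 2 * ((m - n) / (m ^ 3 - n)) - 1) / ((m - n) / (m ^ 3 - n) - 1) = n"
        unfolding eq using n mm by simp
    qed
    also have "\<dots> = - \<chi> (m ^ 3) + (\<Sum>n\<in>UNIV - {m ^ 3}. \<chi> n * quadratic_char ((m - n) * (m ^ 3 - n)))"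
      by (simp add: sum.distrib sum_mult_char_Diff_singleton)
    also have "(\<Sum>n\<in>UNIV - {m ^ 3}. \<chi> n * quadratic_char ((m - n) * (m ^ 3 - n))) =
        (\<Sum>n\<in>UNIV. \<chi> n * quadratic_char ((m - n) * (m ^ 3 - n)))"
      by (intro sum.mono_neutral_left) auto
    finally show ?thesis
      using 3 \<chi>(1) by (simp add: mult_char_power power_fun_apply)
  qed
qed

text \<open>With m = s/t the ratio (s^3 - s) / (t^3 - t) depends on t only through t^2, so t^2 can
  be replaced by v with weight 1 + \<phi>(v). The pairs s = t and s = -t are responsible for 2q. The
  assumption on \<chi>^3 makes the terms \<chi>(m^3) sum to 0.\<close>

lemma norm_square_cubic_sum:
  assumes "\<chi> ^ 3 \<noteq> trivial_char"
  defines "R \<equiv> \<Sum>s\<in>UNIV. \<chi> (s ^ 3 - s)"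
  shows "R * cnj R = 2 * of_nat CARD('a) + (\<Sum>n\<in>UNIV. \<chi> n * cubic_char_sum n)"
proof -
  have "R * cnj R = (\<Sum>t\<in>UNIV. \<Sum>s\<in>UNIV. \<chi> ((s ^ 3 - s) / (t ^ 3 - t)))"
    unfolding R_def cnj_sum sum_product
    using \<chi>(1) by (subst sum.swap) (simp add: cnj_mult_char mult_char_divide divide_inverse[of "\<chi> _"])
  also have "\<dots> = (\<Sum>t\<in>UNIV. \<Sum>m\<in>UNIV. \<chi> (m * (m ^ 2 * t ^ 2 - 1) / (t ^ 2 - 1)))"
  proof (rule sum.cong)
    fix t :: 'a
    show "(\<Sum>s\<in>UNIV. \<chi> ((s ^ 3 - s) / (t ^ 3 - t))) =
        (\<Sum>m\<in>UNIV. \<chi> (m * (m ^ 2 * t ^ 2 - 1) / (t ^ 2 - 1)))"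
    proof (cases "t = 0")
      \<comment> \<open>Both sides are 0 at t = 0 although the substitution fails there: the left
        one because division by 0 gives 0, the right one because its terms are
        \<open>\<chi> m\<close>.\<close>
      case True
      thus ?thesis
        using \<chi> by (simp add: sum_mult_char)
    next
      case False
      have "((t * m + 0) ^ 3 - (t * m + 0)) / (t ^ 3 - t) = m * (m ^ 2 * t ^ 2 - 1) / (t ^ 2 - 1)" for m
      proof -
        have "(t * m + 0) ^ 3 - (t * m + 0) = t * (m * (m ^ 2 * t ^ 2 - 1))" "t ^ 3 - t = t * (t ^ 2 - 1)"
          by (simp_all add: algebra_simps power2_eq_square power3_eq_cube)
        thus ?thesis
          using False by simp
      qed
      thus ?thesis
        using sum_affine[OF False, of "\<lambda>s. \<chi> ((s ^ 3 - s) / (t ^ 3 - t))" 0] by simp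
    qed
  qed simp
  also have "\<dots> = (\<Sum>m\<in>UNIV. \<Sum>t\<in>UNIV. \<chi> (m * (m ^ 2 * t ^ 2 - 1) / (t ^ 2 - 1)))"
    by (rule sum.swap)
  also have "\<dots> = (\<Sum>m\<in>UNIV. \<Sum>v\<in>UNIV. (1 + quadratic_char v) * \<chi> (m * (m ^ 2 * v - 1) / (v - 1)))"
  proof (rule sum.cong)
    fix m :: 'a
    show "(\<Sum>t\<in>UNIV. \<chi> (m * (m ^ 2 * t ^ 2 - 1) / (t ^ 2 - 1))) =
        (\<Sum>v\<in>UNIV. (1 + quadratic_char v) * \<chi> (m * (m ^ 2 * v - 1) / (v - 1)))"
      by (rule sum_over_squares[OF odd_card, of "\<lambda>v. \<chi> (m * (m ^ 2 * v - 1) / (v - 1))"])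
  qed simp
  also have "\<dots> = (\<Sum>m\<in>UNIV. \<Sum>n\<in>UNIV. \<chi> n * quadratic_char ((m - n) * (m ^ 3 - n))) -
      (\<Sum>m\<in>UNIV. (\<chi> ^ 3) m) + (\<Sum>m\<in>(UNIV :: 'a set). if m ^ 2 = 1 then of_nat CARD('a) else 0)"
    unfolding mobius_substitution_ratio by (simp add: sum.distrib sum_subtractf)
  also have "(\<Sum>m\<in>UNIV. (\<chi> ^ 3) m) = 0"
    using assms \<chi> by (intro sum_mult_char) auto
  also have "(\<Sum>m\<in>(UNIV :: 'a set). if m ^ 2 = 1 then of_nat CARD('a) else 0) = 2 * (of_nat CARD('a) :: complex)"
    using sum_over_squares[OF odd_card, of "\<lambda>v. if v = 1 then of_nat CARD('a) else 0"] by (simp add: if_distrib[of "(*) _"] cong: if_cong)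
  also have "(\<Sum>m\<in>UNIV. \<Sum>n\<in>UNIV. \<chi> n * quadratic_char ((m - n) * (m ^ 3 - n))) =
      (\<Sum>n\<in>UNIV. \<chi> n * (\<Sum>m\<in>UNIV. quadratic_char ((m - n) * (m ^ 3 - n))))"
    by (subst sum.swap) (simp add: sum_distrib_left)
  also have "\<dots> = (\<Sum>n\<in>UNIV. \<chi> n * cubic_char_sum n - \<chi> n)"
  proof (rule sum.cong)
    fix n
    show "\<chi> n * (\<Sum>m\<in>UNIV. quadratic_char ((m - n) * (m ^ 3 - n))) = \<chi> n * cubic_char_sum n - \<chi> n"
    proof (cases "n = 0")
      case False
      show ?thesis
        unfolding sum_factored_quartic_to_cubic[OF False three] by (simp add: algebra_simps)
    qed (use \<chi> in simp)
  qed simp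
  also have "\<dots> = (\<Sum>n\<in>UNIV. \<chi> n * cubic_char_sum n)"
    using \<chi> by (simp add: sum_subtractf sum_mult_char)
  finally show ?thesis
    by simp
qed

end

end

section \<open>Greene's series as a double sum\<close>

text \<open>With z = x / (1 - x) the whole dependence on \<psi> sits in a single value of \<psi>, as
  the orthogonality relation requires. The sign \<psi>(-1) from the definition is absorbed into
  \<psi>(-z).\<close>

lemma char_binom_twist:
  fixes A B \<psi> :: "'a::finite_field \<Rightarrow> complex"
  assumes "mult_char A" "mult_char B" "mult_char \<psi>"
  shows "char_binom (A * \<psi>) (B * \<psi>) =
    B (-1) / of_nat CARD('a) * (\<Sum>z\<in>UNIV. \<psi> (- z) * (A z * inverse (A (1 + z)) * B (1 + z)))"
proof -
  have "(\<Sum>x\<in>UNIV. (A * \<psi>) x * inverse (B * \<psi>) (1 - x)) =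
      (\<Sum>x\<in>UNIV - {1}. (A * \<psi>) x * inverse (B * \<psi>) (1 - x))"
    using assms by (intro sum.mono_neutral_right) auto
  also have "\<dots> = (\<Sum>z\<in>UNIV - {-1}. \<psi> z * (A z * inverse (A (1 + z)) * B (1 + z)))"
  proof (rule sum.reindex_bij_witness[of _ "\<lambda>z. z / (1 + z)" "\<lambda>x. x / (1 - x)"])
    fix z :: 'a assume "z \<in> UNIV - {-1}"
    hence z: "1 + z \<noteq> 0"
      by (auto simp: add_eq_0_iff)
    thus "z / (1 + z) / (1 - z / (1 + z)) = z"
      by (simp add: field_simps)
    show "z / (1 + z) \<in> UNIV - {1}"
      using z by (simp add: divide_eq_eq)
  next
    fix x :: 'a assume "x \<in> UNIV - {1}"
    hence x: "1 - x \<noteq> 0"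
      by auto
    thus "x / (1 - x) / (1 + x / (1 - x)) = x"
      by (simp add: field_simps)
    show "x / (1 - x) \<in> UNIV - {-1}"
      using x by (auto simp: divide_eq_eq)
    have "1 + x / (1 - x) = inverse (1 - x)"
      using x by (simp add: field_simps)
    thus "\<psi> (x / (1 - x)) * (A (x / (1 - x)) * inverse (A (1 + x / (1 - x))) * B (1 + x / (1 - x))) =
        (A * \<psi>) x * inverse (B * \<psi>) (1 - x)"
      using assms x by (simp add: mult_char_inverse mult_char_divide field_simps)
  qed
  also have "\<dots> = (\<Sum>z\<in>UNIV. \<psi> z * (A z * inverse (A (1 + z)) * B (1 + z)))"
    using assms by (intro sum.mono_neutral_left) auto
  also have "\<dots> = \<psi> (-1) * (\<Sum>z\<in>UNIV. \<psi> (- z) * (A z * inverse (A (1 + z)) * B (1 + z)))"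
  proof (subst sum_distrib_left, intro sum.cong refl)
    fix z
    have "\<psi> (-1) * \<psi> (- z) = \<psi> z"
      using assms(3) by (simp flip: mult_char_mult)
    thus "\<psi> z * (A z * inverse (A (1 + z)) * B (1 + z)) =
        \<psi> (-1) * (\<psi> (- z) * (A z * inverse (A (1 + z)) * B (1 + z)))"
      by (simp only: mult.assoc [symmetric])
  qed
  finally show ?thesis
    using mult_char_neg1_square[OF assms(3)] by (simp add: char_binom_def)
qed

text \<open>The three binomials contribute \<psi>(-z), \<psi>(-w) and \<psi>(-u). Summing
  \<psi>(-xzwu) over all \<psi> leaves only u = -1 / (xzw), so one of the three variables
  disappears.\<close>

lemma greene_series_3F2:
  fixes A0 A1 A2 B1 B2 :: "'a::finite_field \<Rightarrow> complex"
  assumes mc: "mult_char A0" "mult_char A1" "mult_char A2" "mult_char B1" "mult_char B2" and x: "x \<noteq> 0"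
  shows "greene_series [A0, A1, A2] [B1, B2] x = B1 (-1) * B2 (-1) / of_nat CARD('a) ^ 2 *
    (\<Sum>z\<in>UNIV. \<Sum>w\<in>UNIV. A1 z * inverse (A1 (1 + z)) * B1 (1 + z) *
      (A2 w * inverse (A2 (1 + w)) * B2 (1 + w)) * inverse (A0 (1 - x * z * w)))"
proof -
  define q where "q = (of_nat CARD('a) :: complex)"
  have "CARD('a) > 1"
    using card_mono[of "UNIV :: 'a set" "{0, 1}"] by simp
  hence q: "q \<noteq> 0" "q - 1 \<noteq> 0"
    by (auto simp: q_def)
  define a where "a u = A0 u * inverse (A0 (1 + u))" for u
  define b where "b z = A1 z * inverse (A1 (1 + z)) * B1 (1 + z)" for z
  define c where "c w = A2 w * inverse (A2 (1 + w)) * B2 (1 + w)" for w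
  define C where "C = B1 (-1) * B2 (-1) / q ^ 3"
  have zero: "b 0 = 0" "c 0 = 0"
    using mc by (simp_all add: b_def c_def)
  have term_eq: "char_binom (A0 * \<psi>) \<psi> * (char_binom (A1 * \<psi>) (B1 * \<psi>) * char_binom (A2 * \<psi>) (B2 * \<psi>)) * \<psi> x =
      C * (\<Sum>z\<in>UNIV. \<Sum>w\<in>UNIV. \<Sum>u\<in>UNIV. b z * c w * a u * \<psi> (- (x * z * w * u)))"
    if \<psi>: "mult_char \<psi>" for \<psi>
  proof -
    \<comment> \<open>The first binomial has lower parameter \<psi> alone, so it is treated as
      having the trivial character as its second parameter before the twist. The constant 1 would
      not be a character.\<close>
    have "trivial_char * \<psi> = \<psi>"
      using \<psi> by (auto simp: fun_eq_iff trivial_char_def)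
    moreover have "A0 z * inverse (A0 (1 + z)) * trivial_char (1 + z) = a z" for z
      using mc(1) by (simp add: a_def trivial_char_def)
    ultimately have 0: "char_binom (A0 * \<psi>) \<psi> = 1 / q * (\<Sum>u\<in>UNIV. \<psi> (- u) * a u)"
      using char_binom_twist[OF mc(1) mult_char_trivial \<psi>] by (simp add: q_def trivial_char_def[of "-1"])
    have 1: "char_binom (A1 * \<psi>) (B1 * \<psi>) = B1 (-1) / q * (\<Sum>z\<in>UNIV. \<psi> (- z) * b z)"
      unfolding b_def q_def by (rule char_binom_twist) (fact mc \<psi>)+
    have 2: "char_binom (A2 * \<psi>) (B2 * \<psi>) = B2 (-1) / q * (\<Sum>w\<in>UNIV. \<psi> (- w) * c w)"
      unfolding c_def q_def by (rule char_binom_twist) (fact mc \<psi>)+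
    have "b z * c w * a u * \<psi> (- (x * z * w * u)) =
        \<psi> (- z) * b z * (\<psi> (- w) * c w * (\<psi> (- u) * a u * \<psi> x))" for z w u
    proof -
      have "- (x * z * w * u) = (- z) * (- w) * (- u) * x"
        by simp
      thus ?thesis
        by (simp only: mult_char_mult[OF \<psi>] mult_ac)
    qed
    hence "(\<Sum>z\<in>UNIV. \<Sum>w\<in>UNIV. \<Sum>u\<in>UNIV. b z * c w * a u * \<psi> (- (x * z * w * u))) =
        (\<Sum>z\<in>UNIV. \<psi> (- z) * b z) * ((\<Sum>w\<in>UNIV. \<psi> (- w) * c w) * ((\<Sum>u\<in>UNIV. \<psi> (- u) * a u) * \<psi> x))"
      by (simp only: sum_distrib_left [symmetric] sum_distrib_right [symmetric])
    thus ?thesis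
      unfolding 0 1 2 C_def using q by (simp add: power3_eq_cube mult_ac)
  qed
  have inner: "(\<Sum>u\<in>UNIV. b z * c w * a u * (\<Sum>\<psi> | mult_char \<psi>. \<psi> (- (x * z * w * u)))) =
      (q - 1) * (b z * c w * inverse (A0 (1 - x * z * w)))" for z w
  proof (cases "z = 0 \<or> w = 0")
    case False
    define v where "v = x * z * w"
    have v: "v \<noteq> 0"
      using False x by (simp add: v_def)
    have "(\<Sum>u\<in>UNIV. b z * c w * a u * (\<Sum>\<psi> | mult_char \<psi>. \<psi> (- (v * u)))) =
        (\<Sum>u\<in>UNIV. if u = - (1 / v) then (q - 1) * (b z * c w * a u) else 0)"
    proof (intro sum.cong refl)
      fix u
      have "- (v * u) = 1 \<longleftrightarrow> u = - (1 / v)"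
        using v by (metis minus_divide_left minus_minus mult.commute nonzero_eq_divide_eq)
      thus "b z * c w * a u * (\<Sum>\<psi> | mult_char \<psi>. \<psi> (- (v * u))) =
          (if u = - (1 / v) then (q - 1) * (b z * c w * a u) else 0)"
        by (simp add: sum_mult_chars q_def)
    qed
    also have "\<dots> = (q - 1) * (b z * c w * a (- (1 / v)))"
      by simp
    also have "a (- (1 / v)) = inverse (A0 (1 - v))"
    proof -
      have "1 - v = (1 + - (1 / v)) / (- (1 / v))"
        using v by (simp add: field_simps)
      hence "A0 (1 - v) = A0 (1 + - (1 / v)) / A0 (- (1 / v))"
        using mult_char_divide[OF mc(1)] by metis
      thus ?thesis
        by (simp add: a_def divide_inverse)
    qed
    finally show ?thesis
      by (simp add: v_def)
  qed (auto simp: zero)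
  have "greene_series [A0, A1, A2] [B1, B2] x = q / (q - 1) * (\<Sum>\<psi> | mult_char \<psi>.
      char_binom (A0 * \<psi>) \<psi> * (char_binom (A1 * \<psi>) (B1 * \<psi>) * char_binom (A2 * \<psi>) (B2 * \<psi>)) * \<psi> x)"
    by (simp add: greene_series_def q_def numeral_2_eq_2)
  also have "\<dots> = q / (q - 1) * (C * (\<Sum>\<psi> | mult_char \<psi>.
      \<Sum>z\<in>UNIV. \<Sum>w\<in>UNIV. \<Sum>u\<in>UNIV. b z * c w * a u * \<psi> (- (x * z * w * u))))"
    by (simp add: term_eq sum_distrib_left)
  also have "(\<Sum>\<psi> | mult_char \<psi>. \<Sum>z\<in>UNIV. \<Sum>w\<in>UNIV. \<Sum>u\<in>UNIV. b z * c w * a u * \<psi> (- (x * z * w * u))) =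
      (\<Sum>z\<in>UNIV. \<Sum>w\<in>UNIV. \<Sum>u\<in>UNIV. \<Sum>\<psi> | mult_char \<psi>. b z * c w * a u * \<psi> (- (x * z * w * u)))"
    by (simp only: sum.swap[of _ _ "{\<psi>. mult_char \<psi>}"])
  also have "\<dots> = (q - 1) * (\<Sum>z\<in>UNIV. \<Sum>w\<in>UNIV. b z * c w * inverse (A0 (1 - x * z * w)))"
    unfolding sum_distrib_left[symmetric, of "b _ * c _ * a _"] inner by (simp add: sum_distrib_left)
  finally show ?thesis
    using q by (simp add: C_def b_def c_def power2_eq_square power3_eq_cube flip: q_def)
qed

context
  assumes odd_card: "odd CARD('a::finite_field)"
begin

lemma series_double_sum:
  fixes \<chi> :: "'a \<Rightarrow> complex"
  assumes \<chi>: "mult_char \<chi>" "\<chi> (-1) = 1"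
  shows "greene_series [\<chi>, \<chi> ^ 3, \<chi> ^ 2 * quadratic_char] [\<chi> ^ 4, \<chi> ^ 2] (-8) = 1 / of_nat CARD('a) ^ 2 *
    (\<Sum>z\<in>UNIV. \<Sum>w\<in>UNIV. \<chi> (z ^ 3 * (1 + z) * w ^ 2 / (1 + 8 * z * w)) * quadratic_char (w * (1 + w)))"
proof -
  have two: "(2::'a) \<noteq> 0"
    using two_neq_0[OF odd_card] .
  hence "(2::'a) ^ 3 \<noteq> 0"
    by (rule power_not_zero)
  hence eight: "(-8::'a) \<noteq> 0"
    by simp
  note qc = mult_char_quadratic[OF odd_card]
  have "(\<chi> ^ 3) z * inverse ((\<chi> ^ 3) (1 + z)) * (\<chi> ^ 4) (1 + z) *
      ((\<chi> ^ 2 * quadratic_char) w * inverse ((\<chi> ^ 2 * quadratic_char) (1 + w)) * (\<chi> ^ 2) (1 + w)) *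
      inverse (\<chi> (1 - (-8) * z * w)) =
      \<chi> (z ^ 3 * (1 + z) * w ^ 2 / (1 + 8 * z * w)) * quadratic_char (w * (1 + w))" for z w
  proof -
    have 1: "inverse ((\<chi> ^ 3) (1 + z)) * (\<chi> ^ 4) (1 + z) = \<chi> (1 + z)"
      by (cases "\<chi> (1 + z) = 0") (simp_all add: power_fun_apply field_simps eval_nat_numeral)
    have 2: "inverse ((\<chi> ^ 2 * quadratic_char) (1 + w)) * (\<chi> ^ 2) (1 + w) = quadratic_char (1 + w)"
      using \<chi>(1) by (cases "1 + w = 0") (simp_all add: power_fun_apply)
    have "(\<chi> ^ 3) z * inverse ((\<chi> ^ 3) (1 + z)) * (\<chi> ^ 4) (1 + z) *
      ((\<chi> ^ 2 * quadratic_char) w * inverse ((\<chi> ^ 2 * quadratic_char) (1 + w)) * (\<chi> ^ 2) (1 + w)) *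
      inverse (\<chi> (1 - (-8) * z * w)) = (\<chi> ^ 3) z * \<chi> (1 + z) *
      ((\<chi> ^ 2 * quadratic_char) w * quadratic_char (1 + w)) * inverse (\<chi> (1 + 8 * z * w))"
      by (simp only: mult.assoc 1 2) simp
    also have "\<dots> = \<chi> (z ^ 3 * (1 + z) * w ^ 2 / (1 + 8 * z * w)) * quadratic_char (w * (1 + w))"
      using \<chi>(1) qc by (simp add: power_fun_apply mult_char_mult mult_char_power mult_char_divide divide_inverse[of "_ * _ :: complex"] mult_ac)
    finally show ?thesis .
  qed
  moreover have "(\<chi> ^ 4) (-1) * (\<chi> ^ 2) (-1) = 1"
    by (simp add: power_fun_apply \<chi>(2))
  moreover have "greene_series [\<chi>, \<chi> ^ 3, \<chi> ^ 2 * quadratic_char] [\<chi> ^ 4, \<chi> ^ 2] (-8) =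
    (\<chi> ^ 4) (-1) * (\<chi> ^ 2) (-1) / of_nat CARD('a) ^ 2 *
    (\<Sum>z\<in>UNIV. \<Sum>w\<in>UNIV. (\<chi> ^ 3) z * inverse ((\<chi> ^ 3) (1 + z)) * (\<chi> ^ 4) (1 + z) *
      ((\<chi> ^ 2 * quadratic_char) w * inverse ((\<chi> ^ 2 * quadratic_char) (1 + w)) * (\<chi> ^ 2) (1 + w)) *
      inverse (\<chi> (1 - (-8) * z * w)))"
    by (intro greene_series_3F2 mult_char_times mult_char_pow \<chi> qc eight) simp_all
  ultimately show ?thesis
    by (simp only:)
qed

text \<open>Y = 8zw replaces w and then k = Y (1 + z) replaces z. The squares pulled out explain the
  shape: Y^2 contributes \<chi>(64), and (8z)^2 is invisible to \<phi>. The sign in z (1 + z) Y^2 =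
  -k (Y - k) is harmless because \<chi>(-1) = 1.\<close>

lemma double_sum_substitution:
  fixes \<chi> :: "'a \<Rightarrow> complex"
  assumes \<chi>: "mult_char \<chi>" "\<chi> (-1) = 1"
  shows "\<chi> 64 * (\<Sum>z\<in>UNIV. \<Sum>w\<in>UNIV.
      \<chi> (z ^ 3 * (1 + z) * w ^ 2 / (1 + 8 * z * w)) * quadratic_char (w * (1 + w))) =
    (\<Sum>k\<in>UNIV. \<Sum>Y\<in>UNIV. \<chi> (k * (Y - k) / (1 + Y)) * quadratic_char (Y ^ 2 + 8 * k - 8 * Y)) -
    quadratic_char (2::'a) * (\<Sum>k\<in>UNIV. (\<chi> ^ 2 * quadratic_char) k)"
proof -
  define G where "G Y k = \<chi> (k * (Y - k) / (1 + Y)) * quadratic_char (Y ^ 2 + 8 * k - 8 * Y)" for Y k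
  define H where "H z Y = \<chi> (z * (1 + z) * Y ^ 2 / (1 + Y)) * quadratic_char (Y * (8 * z + Y))" for z Y
  have two: "(2::'a) \<noteq> 0"
    using two_neq_0[OF odd_card] .
  hence "(2::'a) ^ 3 \<noteq> 0"
    by (rule power_not_zero)
  hence eight: "(8::'a) \<noteq> 0"
    by simp
  have \<chi>_minus: "\<chi> (- y) = \<chi> y" for y
    using mult_char_minus[OF \<chi>(1), of y] \<chi>(2) by simp
  have "\<chi> 64 * (\<Sum>w\<in>UNIV. \<chi> (z ^ 3 * (1 + z) * w ^ 2 / (1 + 8 * z * w)) * quadratic_char (w * (1 + w))) =
      (\<Sum>Y\<in>UNIV. H z Y)" for z
  proof (cases "z = 0")
    case True
    thus ?thesis
      using \<chi>(1) by (simp add: H_def)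
  next
    case False
    hence z: "8 * z \<noteq> 0"
      using eight by simp
    have "H z (8 * z * w + 0) =
        \<chi> 64 * (\<chi> (z ^ 3 * (1 + z) * w ^ 2 / (1 + 8 * z * w)) * quadratic_char (w * (1 + w)))" for w
    proof -
      have 1: "z * (1 + z) * (8 * z * w + 0) ^ 2 / (1 + (8 * z * w + 0)) =
          64 * (z ^ 3 * (1 + z) * w ^ 2 / (1 + 8 * z * w))"
        by (simp add: power2_eq_square power3_eq_cube)
      have "(8 * z * w + 0) * (8 * z + (8 * z * w + 0)) = (8 * z) ^ 2 * (w * (1 + w))"
        by (simp add: algebra_simps power2_eq_square)
      hence 2: "quadratic_char ((8 * z * w + 0) * (8 * z + (8 * z * w + 0))) = quadratic_char (w * (1 + w))"
        by (simp only: quadratic_char_mult_square[OF odd_card z])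
      show ?thesis
        unfolding H_def 1 2 using \<chi>(1) by (simp only: mult_char_mult mult.assoc)
    qed
    thus ?thesis
      unfolding sum_affine[OF z, of "H z" 0, symmetric] by (simp only: sum_distrib_left)
  qed
  note inner = this
  have "\<chi> 64 * (\<Sum>z\<in>UNIV. \<Sum>w\<in>UNIV.
      \<chi> (z ^ 3 * (1 + z) * w ^ 2 / (1 + 8 * z * w)) * quadratic_char (w * (1 + w))) =
      (\<Sum>z\<in>UNIV. \<Sum>Y\<in>UNIV. H z Y)"
    by (subst sum_distrib_left) (simp only: inner)
  also have "\<dots> = (\<Sum>Y\<in>UNIV. \<Sum>z\<in>UNIV. H z Y)"
    by (rule sum.swap)
  also have "\<dots> = (\<Sum>Y\<in>UNIV - {0}. \<Sum>z\<in>UNIV. H z Y)"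
    using \<chi>(1) by (intro sum.mono_neutral_right) (auto simp: H_def)
  also have "\<dots> = (\<Sum>Y\<in>UNIV - {0}. \<Sum>k\<in>UNIV. G Y k)"
  proof (rule sum.cong[OF refl])
    fix Y :: 'a assume "Y \<in> UNIV - {0}"
    hence Y: "Y \<noteq> 0"
      by simp
    have "H z Y = G Y (Y * z + Y)" for z
    proof -
      have "(Y * z + Y) * (Y - (Y * z + Y)) / (1 + Y) = - (z * (1 + z) * Y ^ 2 / (1 + Y))"
        unfolding minus_divide_left by (rule arg_cong[of _ _ "\<lambda>u. u / (1 + Y)"]) (simp add: algebra_simps power2_eq_square)
      moreover have "Y ^ 2 + 8 * (Y * z + Y) - 8 * Y = Y * (8 * z + Y)"
        by (simp add: algebra_simps power2_eq_square)
      ultimately show ?thesis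
        by (simp only: G_def H_def \<chi>_minus)
    qed
    thus "(\<Sum>z\<in>UNIV. H z Y) = (\<Sum>k\<in>UNIV. G Y k)"
      using sum_affine[OF Y, of "G Y" Y] by simp
  qed
  also have "\<dots> = (\<Sum>Y\<in>UNIV. \<Sum>k\<in>UNIV. G Y k) - (\<Sum>k\<in>UNIV. G 0 k)"
    by (subst sum.remove[of UNIV 0]) auto
  \<comment> \<open>For Y = 0 the second substitution is not invertible: the old summand vanishes
    there, while the new one is \<chi>(k)^2 \<phi>(8k). Subtracting this fibre produces the term
    that ends up with \<delta>.\<close>
  also have "(\<Sum>k\<in>UNIV. G 0 k) = quadratic_char (2::'a) * (\<Sum>k\<in>UNIV. (\<chi> ^ 2 * quadratic_char) k)"
  proof -
    have "G 0 k = quadratic_char (2::'a) * (\<chi> ^ 2 * quadratic_char) k" for k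
    proof -
      have "8 * k = 2 ^ 2 * (2 * k)"
        by simp
      hence "quadratic_char (8 * k) = quadratic_char (2 * k)"
        by (simp only: quadratic_char_mult_square[OF odd_card two])
      also have "\<dots> = quadratic_char (2::'a) * quadratic_char k"
        by (rule mult_char_mult) (rule mult_char_quadratic[OF odd_card])
      finally show ?thesis
        using \<chi>_minus[of "k * k"] \<chi>(1) by (simp add: G_def power_fun_apply mult_char_mult power2_eq_square)
    qed
    thus ?thesis
      by (simp add: sum_distrib_left)
  qed
  also have "(\<Sum>Y\<in>UNIV. \<Sum>k\<in>UNIV. G Y k) = (\<Sum>k\<in>UNIV. \<Sum>Y\<in>UNIV. G Y k)"
    by (rule sum.swap)
  finally show ?thesis
    by (simp only: G_def)
qed

lemma series_eq_norm_square:
  fixes \<chi> :: "'a \<Rightarrow> complex"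
  assumes \<chi>: "mult_char \<chi>" "\<chi> \<noteq> trivial_char" "\<chi> ^ 3 \<noteq> trivial_char" "\<chi> (-1) = 1" and three: "(3::'a) \<noteq> 0"
  defines "R \<equiv> \<Sum>s\<in>UNIV. \<chi> (s ^ 3 - s)"
  shows "\<chi> 64 * of_nat CARD('a) ^ 2 *
      greene_series [\<chi>, \<chi> ^ 3, \<chi> ^ 2 * quadratic_char] [\<chi> ^ 4, \<chi> ^ 2] (-8) =
    R * cnj R - of_nat CARD('a) - quadratic_char (2::'a) * (\<Sum>k\<in>UNIV. (\<chi> ^ 2 * quadratic_char) k)"
proof -
  have "\<chi> 64 * of_nat CARD('a) ^ 2 *
      greene_series [\<chi>, \<chi> ^ 3, \<chi> ^ 2 * quadratic_char] [\<chi> ^ 4, \<chi> ^ 2] (-8) =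
    \<chi> 64 * (\<Sum>z\<in>UNIV. \<Sum>w\<in>UNIV.
      \<chi> (z ^ 3 * (1 + z) * w ^ 2 / (1 + 8 * z * w)) * quadratic_char (w * (1 + w)))"
    unfolding series_double_sum[OF \<chi>(1,4)] by simp
  also have "\<dots> = R * cnj R - of_nat CARD('a) - quadratic_char (2::'a) * (\<Sum>k\<in>UNIV. (\<chi> ^ 2 * quadratic_char) k)"
    unfolding double_sum_substitution[OF \<chi>(1,4)] double_sum_eq[OF odd_card \<chi>(1,2,4) three]
      R_def norm_square_cubic_sum[OF odd_card \<chi>(1,2,4) three \<chi>(3)] by simp
  finally show ?thesis .
qed

text \<open>Centering by x = (u + 1) / 2 gives x (1 - x) = (1 - u^2) / 4. Passing to v = u^2 splits
  the sum into a complete character sum, which is 0, and the Jacobi sum with \<phi>.\<close>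

lemma jacobi_sum_self:
  fixes A :: "'a \<Rightarrow> complex"
  assumes A: "mult_char A" "A \<noteq> trivial_char"
  shows "jacobi_sum A A = inverse (A 4) * jacobi_sum quadratic_char A"
proof -
  have two: "(2::'a) \<noteq> 0"
    using two_neq_0[OF odd_card] .
  have "(2::'a) ^ 2 \<noteq> 0"
    using two by (rule power_not_zero)
  hence four: "(4::'a) \<noteq> 0"
    by simp
  have "jacobi_sum A A = (\<Sum>u\<in>UNIV. A (1 / 2 * u + 1 / 2) * A (1 - (1 / 2 * u + 1 / 2)))"
    unfolding jacobi_sum_def
    by (rule sum_affine[of "1 / 2" "\<lambda>x. A x * A (1 - x)" "1 / 2", symmetric]) (use two in simp)
  also have "\<dots> = (\<Sum>u\<in>UNIV. inverse (A 4) * A (1 - u ^ 2))"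
  proof (intro sum.cong refl)
    fix u :: 'a
    have half: "1 / 2 * u + 1 / 2 = (u + 1) / 2" "1 - (u + 1) / 2 = (1 - u) / 2"
      using two by (simp_all add: field_simps)
    have eq: "(u + 1) / 2 * ((1 - u) / 2) = inverse 4 * (1 - u ^ 2)"
      using four by (simp add: field_simps power2_eq_square)
    show "A (1 / 2 * u + 1 / 2) * A (1 - (1 / 2 * u + 1 / 2)) = inverse (A 4) * A (1 - u ^ 2)"
      unfolding half mult_char_mult[OF A(1), symmetric] eq
      by (simp only: mult_char_mult[OF A(1)] mult_char_inverse[OF A(1)])
  qed
  also have "\<dots> = inverse (A 4) * (\<Sum>v\<in>UNIV. (1 + quadratic_char v) * A (1 - v))"
    unfolding sum_over_squares[OF odd_card, of "\<lambda>v. A (1 - v)", symmetric] by (simp add: sum_distrib_left)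
  also have "(\<Sum>v\<in>UNIV. (1 + quadratic_char v) * A (1 - v)) =
      (\<Sum>v\<in>UNIV. A ((-1) * v + 1)) + jacobi_sum quadratic_char A"
    by (simp add: jacobi_sum_def ring_distribs sum.distrib)
  also have "(\<Sum>v\<in>UNIV. A ((-1) * v + 1)) = 0"
    using sum_affine[of "-1" A 1] sum_mult_char[OF A] by simp
  finally show ?thesis
    by simp
qed

text \<open>Both Jacobi sums in \<open>jacobi_sum_self\<close> are quotients of Gauss sums.
  Multiplying the claim by g(A) exposes g(A)^2 as the first of them, and g(A) is cancelled at the
  end because it is nonzero.\<close>

lemma hasse_davenport_quadratic:
  fixes A :: "'a \<Rightarrow> complex"
  assumes pr: "prime p" "CARD('a) = p ^ r" "primitive_root_unity p \<zeta>"
    and A: "mult_char A" "A ^ 2 \<noteq> trivial_char"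
  shows "gauss_sum p r \<zeta> A * gauss_sum p r \<zeta> (A * quadratic_char) =
    inverse (A 4) * gauss_sum p r \<zeta> (A ^ 2) * gauss_sum p r \<zeta> (quadratic_char :: 'a \<Rightarrow> complex)"
proof -
  note qc = mult_char_quadratic[OF odd_card]
  have AA: "A * A = A ^ 2"
    by (simp add: power2_eq_square)
  have nontriv: "A \<noteq> trivial_char"
  proof
    assume "A = trivial_char"
    hence "A ^ 2 = trivial_char"
      by (simp add: fun_eq_iff power_fun_apply trivial_char_def)
    with A(2) show False ..
  qed
  have nontriv': "quadratic_char * A \<noteq> trivial_char"
  proof
    assume eq: "quadratic_char * A = trivial_char"
    have "(A ^ 2) x = ((quadratic_char * A) x) ^ 2" for x
      using quadratic_char_times_self[of x] A(1)
      by (simp add: power_fun_apply power_mult_distrib power2_eq_square[of "quadratic_char x"] trivial_char_def)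
    hence "A ^ 2 = trivial_char"
      by (simp add: eq fun_eq_iff trivial_char_def)
    with A(2) show False ..
  qed
  have nz: "gauss_sum p r \<zeta> A \<noteq> 0"
    using gauss_sum_times_cnj[OF pr A(1) nontriv] by auto
  have "gauss_sum p r \<zeta> A * (gauss_sum p r \<zeta> A * gauss_sum p r \<zeta> (A * quadratic_char)) =
      jacobi_sum A A * gauss_sum p r \<zeta> (A ^ 2) * gauss_sum p r \<zeta> (quadratic_char * A)"
    using gauss_sum_mult[OF pr A(1) A(1)] A(2) by (simp add: AA mult.commute[of A quadratic_char] flip: mult.assoc)
  also have "\<dots> = inverse (A 4) * gauss_sum p r \<zeta> (A ^ 2) *
      (jacobi_sum quadratic_char A * gauss_sum p r \<zeta> (quadratic_char * A))"
    by (simp add: jacobi_sum_self[OF A(1) nontriv])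
  also have "jacobi_sum quadratic_char A * gauss_sum p r \<zeta> (quadratic_char * A) =
      gauss_sum p r \<zeta> (quadratic_char :: 'a \<Rightarrow> complex) * gauss_sum p r \<zeta> A"
    by (rule gauss_sum_mult[OF pr qc A(1) nontriv', symmetric])
  finally have "gauss_sum p r \<zeta> A * (gauss_sum p r \<zeta> A * gauss_sum p r \<zeta> (A * quadratic_char)) =
      gauss_sum p r \<zeta> A *
        (inverse (A 4) * gauss_sum p r \<zeta> (A ^ 2) * gauss_sum p r \<zeta> (quadratic_char :: 'a \<Rightarrow> complex))"
    by (simp only: mult_ac)
  thus ?thesis
    by (rule iffD1[OF mult_left_cancel[OF nz]])
qed

end

section \<open>Evaluation\<close>

lemma char_binom_eq_jacobi_sum:
  fixes A B :: "'a::finite_field \<Rightarrow> complex"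
  assumes "B (-1) = 1"
  shows "char_binom A B = jacobi_sum A (inverse B) / of_nat CARD('a)"
  using assms by (simp add: char_binom_def jacobi_sum_def)

context
  fixes p r :: nat and \<zeta> :: complex
  assumes prime_p: "prime p" and card: "CARD('a::finite_field) = p ^ r"
    and \<zeta>: "primitive_root_unity p \<zeta>"
begin

lemma gauss_sum_neq_0:
  assumes "mult_char \<chi>" "\<chi> \<noteq> trivial_char"
  shows "gauss_sum p r \<zeta> (\<chi> :: 'a \<Rightarrow> complex) \<noteq> 0"
  using gauss_sum_times_cnj[OF prime_p card \<zeta> assms] by auto

lemma jacobi_sum_eq_gauss_sums:
  fixes \<chi> \<psi> :: "'a \<Rightarrow> complex"
  assumes "mult_char \<chi>" "mult_char \<psi>" "\<chi> * \<psi> \<noteq> trivial_char"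
  shows "jacobi_sum \<chi> \<psi> = gauss_sum p r \<zeta> \<chi> * gauss_sum p r \<zeta> \<psi> / gauss_sum p r \<zeta> (\<chi> * \<psi>)"
  using gauss_sum_mult[OF prime_p card \<zeta> assms] gauss_sum_neq_0[of "\<chi> * \<psi>"] assms
  by (simp add: mult_char_times field_simps)

lemma jacobi_sum_times_cnj:
  fixes \<chi> \<psi> :: "'a \<Rightarrow> complex"
  assumes "mult_char \<chi>" "mult_char \<psi>" "\<chi> \<noteq> trivial_char" "\<psi> \<noteq> trivial_char" "\<chi> * \<psi> \<noteq> trivial_char"
  shows "jacobi_sum \<chi> \<psi> * cnj (jacobi_sum \<chi> \<psi>) = of_nat CARD('a)"
proof -
  have "jacobi_sum \<chi> \<psi> * cnj (jacobi_sum \<chi> \<psi>) =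
      (gauss_sum p r \<zeta> \<chi> * cnj (gauss_sum p r \<zeta> \<chi>)) * (gauss_sum p r \<zeta> \<psi> * cnj (gauss_sum p r \<zeta> \<psi>)) /
      (gauss_sum p r \<zeta> (\<chi> * \<psi>) * cnj (gauss_sum p r \<zeta> (\<chi> * \<psi>)))"
    by (simp add: jacobi_sum_eq_gauss_sums assms)
  thus ?thesis
    using assms by (simp add: gauss_sum_times_cnj[OF prime_p card \<zeta>] mult_char_times)
qed

text \<open>The two Jacobi sums J1 and J2 in S have absolute value sqrt q, so conjugation sends S to
  q/J1 + q/J2 = q S / (J1 J2). Thus S^2 is |S|^2 J1 J2 / q, and it remains to recognize the Gauss
  sum factor as q / (A(16) J1 J2).\<close>

lemma norm_square_jacobi_sums:
  fixes A :: "'a \<Rightarrow> complex"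
  assumes odd_card: "odd CARD('a)" and A: "mult_char A" "A ^ 2 \<noteq> trivial_char" "A ^ 6 \<noteq> trivial_char"
  defines "S \<equiv> jacobi_sum (A ^ 3) (inverse (A ^ 2)) + jacobi_sum (A ^ 3 * quadratic_char) (inverse (A ^ 2))"
  shows "gauss_sum p r \<zeta> (A ^ 2) ^ 2 * gauss_sum p r \<zeta> (inverse (A ^ 6)) /
      (of_nat CARD('a) * gauss_sum p r \<zeta> (inverse (A ^ 2))) * S ^ 2 = inverse (A 16) * (S * cnj S)"
proof -
  note qc = mult_char_quadratic[OF odd_card]
  define q where "q = (of_nat CARD('a) :: complex)"
  define g where "g = (gauss_sum p r \<zeta> :: ('a \<Rightarrow> complex) \<Rightarrow> complex)"
  have q: "q \<noteq> 0"
    by (simp add: q_def)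
  have mc: "mult_char (A ^ 2)" "mult_char (A ^ 3)" "mult_char (A ^ 6)" "mult_char (inverse (A ^ 2))"
    "mult_char (inverse (A ^ 6))" "mult_char (A * quadratic_char)" "mult_char (A ^ 3 * quadratic_char)"
    by (intro mult_char_times mult_char_pow mult_char_inverse_fun A(1) qc; simp)+
  have neg1: "(A ^ 2) (-1) = 1" "(A ^ 6) (-1) = 1"
    using mult_char_power[OF A(1), of "-1" 2] mult_char_power[OF A(1), of "-1" 6] A(1)
    by (simp_all add: power_fun_apply)
  have triv_pow: "trivial_char ^ n = trivial_char" if "n > 0" for n
    using that by (simp add: fun_eq_iff power_fun_apply trivial_char_def)
  have square: "(B * quadratic_char) ^ 2 = B ^ 2" if "mult_char B" for B :: "'a \<Rightarrow> complex"
  proof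
    fix x
    show "((B * quadratic_char) ^ 2) x = (B ^ 2) x"
      using that quadratic_char_times_self[of x]
      by (simp add: power_fun_apply power_mult_distrib power2_eq_square[of "quadratic_char x"] trivial_char_def)
  qed
  have A6: "(A ^ 3) ^ 2 = A ^ 6"
    by (simp flip: power_mult)
  have nt1: "A \<noteq> trivial_char"
    using A(2) triv_pow[of 2] by auto
  \<comment> \<open>Twisting by \<phi> does not change the square of a character, so the assumptions
    on A^2 and A^6 exclude triviality of the twisted characters too.\<close>
  have nt2: "A * quadratic_char \<noteq> trivial_char"
    using A(2) triv_pow[of 2] square[OF A(1)] by (metis zero_less_numeral)
  have nt3: "A ^ 3 \<noteq> trivial_char"
    using A(3) triv_pow[of 2] A6 by (metis zero_less_numeral)
  have nt4: "A ^ 3 * quadratic_char \<noteq> trivial_char"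
    using A(3) triv_pow[of 2] A6 square[OF mc(2)] by (metis zero_less_numeral)
  have inv_nt: "inverse B \<noteq> trivial_char" if "B \<noteq> trivial_char" for B :: "'a \<Rightarrow> complex"
  proof
    assume "inverse B = trivial_char"
    hence "inverse (B x) = trivial_char x" for x
      by (simp flip: inverse_fun_apply)
    hence "B x = trivial_char x" for x
      by (metis inverse_inverse_eq inverse_1 inverse_zero trivial_char_def)
    with that show False
      by (simp add: fun_eq_iff)
  qed
  have prod1: "A ^ 3 * inverse (A ^ 2) = A"
  proof
    fix x
    show "(A ^ 3 * inverse (A ^ 2)) x = A x"
      by (cases "A x = 0") (simp_all add: power_fun_apply power3_eq_cube power2_eq_square field_simps)
  qed
  hence prod2: "A ^ 3 * quadratic_char * inverse (A ^ 2) = A * quadratic_char"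
    by (metis mult.assoc mult.commute)
  define J1 where "J1 = jacobi_sum (A ^ 3) (inverse (A ^ 2))"
  define J2 where "J2 = jacobi_sum (A ^ 3 * quadratic_char) (inverse (A ^ 2))"
  have J1: "J1 = g (A ^ 3) * g (inverse (A ^ 2)) / g A"
    using jacobi_sum_eq_gauss_sums[of "A ^ 3" "inverse (A ^ 2)"] mc nt1 by (simp add: J1_def g_def prod1)
  have J2: "J2 = g (A ^ 3 * quadratic_char) * g (inverse (A ^ 2)) / g (A * quadratic_char)"
    using jacobi_sum_eq_gauss_sums[of "A ^ 3 * quadratic_char" "inverse (A ^ 2)"] mc nt2
    by (simp add: J2_def g_def prod2)
  have cnj1: "J1 * cnj J1 = q"
    unfolding J1_def q_def using mc nt1 nt3 A inv_nt by (intro jacobi_sum_times_cnj) (simp_all add: prod1)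
  have cnj2: "J2 * cnj J2 = q"
    unfolding J2_def q_def using mc nt2 nt4 A inv_nt by (intro jacobi_sum_times_cnj) (simp_all add: prod2)
  have HD1: "g A * g (A * quadratic_char) = inverse (A 4) * g (A ^ 2) * g quadratic_char"
    unfolding g_def by (rule hasse_davenport_quadratic[OF odd_card prime_p card \<zeta> A(1,2)])
  have HD2: "g (A ^ 3) * g (A ^ 3 * quadratic_char) = inverse ((A ^ 3) 4) * g (A ^ 6) * g quadratic_char"
    unfolding g_def A6[symmetric]
    by (rule hasse_davenport_quadratic[OF odd_card prime_p card \<zeta> mc(2)]) (use A(3) A6 in simp)
  have inv2: "g (A ^ 2) * g (inverse (A ^ 2)) = q"
    using gauss_sum_inverse[OF prime_p card \<zeta> mc(1) A(2)] neg1 by (simp add: g_def q_def)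
  have inv6: "g (A ^ 6) * g (inverse (A ^ 6)) = q"
    using gauss_sum_inverse[OF prime_p card \<zeta> mc(3) A(3)] neg1 by (simp add: g_def q_def)
  have nz: "g (A ^ 2) \<noteq> 0" "g (inverse (A ^ 2)) \<noteq> 0" "g (A ^ 6) \<noteq> 0" "g (inverse (A ^ 6)) \<noteq> 0" "J1 \<noteq> 0" "J2 \<noteq> 0"
    using inv2 inv6 cnj1 cnj2 q by auto
  have nz': "g (quadratic_char) \<noteq> 0" "g A \<noteq> 0" "g (A * quadratic_char) \<noteq> 0"
    unfolding g_def
    by (intro gauss_sum_neq_0 qc quadratic_char_neq_trivial[OF odd_card] nt1 nt2 A(1) mc)+
  have two: "(2::'a) \<noteq> 0"
    using two_neq_0[OF odd_card] .
  have "(2::'a) ^ 2 \<noteq> 0"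
    using two by (rule power_not_zero)
  hence four: "A 4 \<noteq> 0"
    using A(1) by simp
  have A16: "A 16 = A 4 ^ 2"
    using mult_char_power[OF A(1), of 4 2] by simp
  have "J1 * J2 = (g (A ^ 3) * g (A ^ 3 * quadratic_char)) * g (inverse (A ^ 2)) ^ 2 / (g A * g (A * quadratic_char))"
    by (simp add: J1 J2 power2_eq_square)
  \<comment> \<open>The two Hasse-Davenport relations, for A^3 and for A, contribute the inverses of
    A(4)^3 and A(4). Their quotient is the inverse of A(4)^2 = A(16), and g(\<phi>) cancels.\<close>
  also have "\<dots> = inverse (A 16) * g (A ^ 6) * g (inverse (A ^ 2)) ^ 2 / g (A ^ 2)"
    unfolding HD1 HD2 using nz nz' four by (simp add: power_fun_apply A16 field_simps power2_eq_square power3_eq_cube)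
  finally have J12: "J1 * J2 * A 16 * g (A ^ 2) = g (A ^ 6) * g (inverse (A ^ 2)) ^ 2"
    using nz four by (simp add: A16 field_simps)
  have "cnj S = q * S / (J1 * J2)"
  proof -
    have "cnj J1 = q / J1" "cnj J2 = q / J2"
      using cnj1 cnj2 nz by (simp_all add: field_simps)
    moreover have "S = J1 + J2"
      by (simp add: S_def J1_def J2_def)
    ultimately show ?thesis
      using nz by (simp add: field_simps)
  qed
  moreover have "g (A ^ 2) ^ 2 * g (inverse (A ^ 6)) / (q * g (inverse (A ^ 2))) = inverse (A 16) * q / (J1 * J2)"
  proof -
    have "g (A ^ 2) ^ 2 * g (inverse (A ^ 6)) * (J1 * J2 * A 16) =
        g (A ^ 2) * g (inverse (A ^ 6)) * (J1 * J2 * A 16 * g (A ^ 2))"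
      by (simp add: power2_eq_square)
    also have "\<dots> = g (A ^ 2) * g (inverse (A ^ 6)) * (g (A ^ 6) * g (inverse (A ^ 2)) ^ 2)"
      by (simp only: J12)
    also have "\<dots> = (g (A ^ 2) * g (inverse (A ^ 2))) * (g (A ^ 6) * g (inverse (A ^ 6))) * g (inverse (A ^ 2))"
      by (simp add: power2_eq_square)
    also have "\<dots> = q ^ 2 * g (inverse (A ^ 2))"
      unfolding inv2 inv6 by (simp add: power2_eq_square)
    finally show ?thesis
      using nz four q by (simp add: A16 field_simps power2_eq_square)
  qed
  ultimately show ?thesis
    by (simp add: g_def q_def power2_eq_square)
qed

end

text \<open>Adding the twist by \<phi> restricts the sum to squares v = s^2, where A^3 takes the
  value \<chi>(s^3). This is why the bracket depends only on \<chi> = A^2. The inversion of s then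
  turns s^3 / (1 - s^2) into the reciprocal of s^3 - s.\<close>

lemma sum_jacobi_sums_eq_cnj:
  fixes A :: "'a::finite_field \<Rightarrow> complex"
  assumes odd_card: "odd CARD('a)" and A: "mult_char A"
  shows "jacobi_sum (A ^ 3) (inverse (A ^ 2)) + jacobi_sum (A ^ 3 * quadratic_char) (inverse (A ^ 2)) =
    cnj (\<Sum>s\<in>UNIV. (A ^ 2) (s ^ 3 - s))"
proof -
  define \<chi> where "\<chi> = A ^ 2"
  have \<chi>: "mult_char \<chi>"
    unfolding \<chi>_def using A by (intro mult_char_pow) auto
  have "jacobi_sum (A ^ 3) (inverse \<chi>) + jacobi_sum (A ^ 3 * quadratic_char) (inverse \<chi>) =
      (\<Sum>v\<in>UNIV. (1 + quadratic_char v) * ((A ^ 3) v * inverse (\<chi> (1 - v))))"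
    by (simp add: jacobi_sum_def ring_distribs sum.distrib mult_ac)
  also have "\<dots> = (\<Sum>s\<in>UNIV. (A ^ 3) (s ^ 2) * inverse (\<chi> (1 - s ^ 2)))"
    by (rule sum_over_squares[OF odd_card, symmetric])
  also have "\<dots> = (\<Sum>s\<in>UNIV. \<chi> (s ^ 3) * inverse (\<chi> (1 - s ^ 2)))"
    using A by (simp add: \<chi>_def power_fun_apply mult_char_power flip: power_mult)
  also have "\<dots> = (\<Sum>s\<in>UNIV. inverse (\<chi> (s ^ 3 - s)))"
  proof (rule sum.reindex_bij_witness[of _ inverse inverse])
    fix s :: 'a
    show "inverse (\<chi> (inverse s ^ 3 - inverse s)) = \<chi> (s ^ 3) * inverse (\<chi> (1 - s ^ 2))"
    proof (cases "s = 0")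
      case False
      hence "inverse s ^ 3 - inverse s = (1 - s ^ 2) / s ^ 3"
        by (simp add: field_simps power2_eq_square power3_eq_cube)
      thus ?thesis
        using \<chi> by (simp add: mult_char_divide divide_inverse[of "\<chi> _"])
    qed (use \<chi> in auto)
  qed auto
  finally show ?thesis
    using \<chi> by (simp add: \<chi>_def [symmetric] cnj_mult_char)
qed

theorem theorem1p9:
  fixes p r :: nat and \<zeta> :: complex and A :: "'a::finite_field \<Rightarrow> complex"
  assumes "prime p" and "odd p" and "p \<noteq> 3"
    and "CARD('a) = p ^ r"
    and "primitive_root_unity p \<zeta>"
    and "mult_char A"
    and "A ^ 2 \<noteq> trivial_char" and "A ^ 6 \<noteq> trivial_char"
  shows "let q = (of_nat CARD('a) :: complex);
             g = (gauss_sum p r \<zeta> :: ('a \<Rightarrow> complex) \<Rightarrow> complex);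
             \<phi> = (quadratic_char :: 'a \<Rightarrow> complex)
         in greene_series [A ^ 2, A ^ 6, A ^ 4 * \<phi>] [A ^ 8, A ^ 4] (- 8) =
              inverse A 256 * g (A ^ 2) ^ 2 * g (inverse (A ^ 6)) / (q * g (inverse (A ^ 2))) *
                (char_binom (A ^ 3) (A ^ 2) + char_binom (A ^ 3 * \<phi>) (A ^ 2)) ^ 2
              - inverse A 4096 / q
              - (q - 1) / q ^ 3 * inverse A 4096 * \<phi> 2 *
                g (inverse (A ^ 2) * \<phi>) * g (A ^ 2 * \<phi>) * char_delta (A ^ 4 * \<phi>)"
proof -
  note pr = assms(1,4,5) and A = assms(6-8)
  define \<phi> where "\<phi> = (quadratic_char :: 'a \<Rightarrow> complex)"
  define \<chi> where "\<chi> = A ^ 2"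
  define q where "q = (of_nat CARD('a) :: complex)"
  define g where "g = (gauss_sum p r \<zeta> :: ('a \<Rightarrow> complex) \<Rightarrow> complex)"
  define R where "R = (\<Sum>s\<in>UNIV. \<chi> (s ^ 3 - s))"
  define S where "S = jacobi_sum (A ^ 3) (inverse \<chi>) + jacobi_sum (A ^ 3 * \<phi>) (inverse \<chi>)"
  have odd_card: "odd CARD('a)"
    using assms(2,4) by simp
  have q: "q \<noteq> 0"
    by (simp add: q_def)
  have two: "(2::'a) \<noteq> 0"
    using two_neq_0[OF odd_card] .
  \<comment> \<open>The exclusion of p = 3 serves the degenerate fibres of the character sums, where
    9 and the discriminants 96 and -3 must be nonzero.\<close>
  have three: "(3::'a) \<noteq> 0"
  proof
    assume "(3::'a) = 0"
    hence "of_nat 3 = (0::'a)"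
      by simp
    hence "p dvd 3"
      using CHAR_eq[OF pr] by (simp only: of_nat_eq_0_iff_char_dvd)
    thus False
      using assms(1,3) primes_dvd_imp_eq[of p 3] by simp
  qed
  have qc: "mult_char \<phi>"
    unfolding \<phi>_def by (rule mult_char_quadratic[OF odd_card])
  have \<chi>: "mult_char \<chi>"
    unfolding \<chi>_def using A(1) by (intro mult_char_pow) auto
  have neg1: "\<chi> (-1) = 1"
    using mult_char_power[OF A(1), of "-1" 2] A(1) by (simp add: \<chi>_def power_fun_apply)
  have powers: "A ^ 4 = \<chi> ^ 2" "A ^ 6 = \<chi> ^ 3" "A ^ 8 = \<chi> ^ 4"
    by (simp_all add: \<chi>_def flip: power_mult)
  have A_powers: "A 256 = \<chi> 16" "A 4096 = \<chi> 64" "A 16 = \<chi> 4"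
    using mult_char_power[OF A(1), of 16 2] mult_char_power[OF A(1), of 64 2] mult_char_power[OF A(1), of 4 2]
    by (simp_all add: \<chi>_def power_fun_apply)
  have \<chi>64: "\<chi> 64 \<noteq> 0" "\<chi> 16 * \<chi> 4 = \<chi> 64"
  proof -
    have "(2::'a) ^ 6 \<noteq> 0"
      using two by (rule power_not_zero)
    thus "\<chi> 64 \<noteq> 0"
      using \<chi> by simp
    show "\<chi> 16 * \<chi> 4 = \<chi> 64"
      using \<chi> by (simp flip: mult_char_mult)
  qed
  have "\<chi> 64 * q ^ 2 * greene_series [\<chi>, \<chi> ^ 3, \<chi> ^ 2 * \<phi>] [\<chi> ^ 4, \<chi> ^ 2] (-8) =
      R * cnj R - q - \<phi> 2 * (\<Sum>k\<in>UNIV. (\<chi> ^ 2 * \<phi>) k)"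
    unfolding q_def R_def \<phi>_def
    using series_eq_norm_square[OF odd_card \<chi> _ _ neg1 three] A(2,3) by (simp add: powers flip: \<chi>_def)
  also have "(\<Sum>k\<in>UNIV. (\<chi> ^ 2 * \<phi>) k) = (q - 1) * char_delta (\<chi> ^ 2 * \<phi>)"
  proof (cases "\<chi> ^ 2 * \<phi> = trivial_char")
    case True
    show ?thesis
      unfolding True by (simp add: char_delta_def sum_trivial_char q_def)
  next
    case False
    have "mult_char (\<chi> ^ 2 * \<phi>)"
      by (intro mult_char_times mult_char_pow \<chi> qc) simp
    thus ?thesis
      using sum_mult_char False by (simp only: char_delta_def if_False mult_zero_right)
  qed
  finally have series: "\<chi> 64 * q ^ 2 * greene_series [\<chi>, \<chi> ^ 3, \<chi> ^ 2 * \<phi>] [\<chi> ^ 4, \<chi> ^ 2] (-8) =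
      R * cnj R - q - \<phi> 2 * ((q - 1) * char_delta (\<chi> ^ 2 * \<phi>))" .
  have S: "S = cnj R"
    unfolding S_def R_def \<phi>_def \<chi>_def by (rule sum_jacobi_sums_eq_cnj[OF odd_card A(1)])
  have binoms: "char_binom (A ^ 3) \<chi> + char_binom (A ^ 3 * \<phi>) \<chi> = S / q"
    by (simp add: char_binom_eq_jacobi_sum neg1 S_def q_def add_divide_distrib)
  have "inverse (\<chi> 16) * g \<chi> ^ 2 * g (inverse (\<chi> ^ 3)) / (q * g (inverse \<chi>)) * (S / q) ^ 2 =
      inverse (\<chi> 16) / q ^ 2 * (g \<chi> ^ 2 * g (inverse (\<chi> ^ 3)) / (q * g (inverse \<chi>)) * S ^ 2)"
    by (simp add: power_divide mult_ac)
  also have "g \<chi> ^ 2 * g (inverse (\<chi> ^ 3)) / (q * g (inverse \<chi>)) * S ^ 2 = inverse (\<chi> 4) * (S * cnj S)"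
    using norm_square_jacobi_sums[OF pr odd_card A]
    by (simp add: powers A_powers g_def q_def S_def \<phi>_def flip: \<chi>_def)
  also have "inverse (\<chi> 16) / q ^ 2 * (inverse (\<chi> 4) * (S * cnj S)) = inverse (\<chi> 64) / q ^ 2 * (R * cnj R)"
    unfolding S \<chi>64(2)[symmetric] by (simp add: mult_ac)
  finally have main: "inverse (\<chi> 16) * g \<chi> ^ 2 * g (inverse (\<chi> ^ 3)) / (q * g (inverse \<chi>)) * (S / q) ^ 2 =
      inverse (\<chi> 64) / q ^ 2 * (R * cnj R)" .
  \<comment> \<open>When \<delta> is nonzero, the two Gauss sums belong to inverse characters, so
    their product is q. This trades the factor (q - 1) / q^2 coming from the lost fibre for the (q -
    1) / q^3 of the statement.\<close>
  have delta: "g (inverse \<chi> * \<phi>) * g (\<chi> * \<phi>) * char_delta (\<chi> ^ 2 * \<phi>) = q * char_delta (\<chi> ^ 2 * \<phi>)"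
  proof (cases "\<chi> ^ 2 * \<phi> = trivial_char")
    case True
    have \<phi>_inv: "inverse (\<phi> x) = \<phi> x" for x
      by (simp add: \<phi>_def)
    have inv: "inverse (\<chi> * \<phi>) = inverse \<chi> * \<phi>"
      by (simp add: fun_eq_iff \<phi>_inv)
    have "\<chi> * \<phi> \<noteq> trivial_char"
    proof
      assume eq: "\<chi> * \<phi> = trivial_char"
      have "\<chi> * (\<chi> * \<phi>) = trivial_char"
        using True by (simp only: power2_eq_square mult.assoc)
      moreover have "\<chi> * trivial_char = \<chi>"
        using \<chi> by (auto simp: fun_eq_iff trivial_char_def)
      ultimately have "\<chi> = trivial_char"
        by (simp only: eq)
      thus False
        using A(2) by (simp only: \<chi>_def)
    qed
    \<comment> \<open>The triviality of \<chi>^2 \<phi> together with \<chi>(-1) = 1 forces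
      \<phi>(-1) = 1, so no sign appears in the product of the Gauss sums.\<close>
    moreover have "(\<chi> * \<phi>) (-1) = 1"
      using fun_cong[OF True, of "-1"] neg1 by (simp add: power_fun_apply trivial_char_def)
    ultimately have "g (\<chi> * \<phi>) * g (inverse \<chi> * \<phi>) = q"
      using gauss_sum_inverse[OF pr mult_char_times[OF \<chi> qc]] by (simp add: g_def q_def inv)
    thus ?thesis
      by (simp add: mult.commute)
  qed (simp add: char_delta_def)
  have "greene_series [\<chi>, \<chi> ^ 3, \<chi> ^ 2 * \<phi>] [\<chi> ^ 4, \<chi> ^ 2] (-8) =
      inverse (\<chi> 64) / q ^ 2 * (R * cnj R - q - \<phi> 2 * ((q - 1) * char_delta (\<chi> ^ 2 * \<phi>)))"
    unfolding series[symmetric] using q \<chi>64(1) by simp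
  also have "\<dots> = inverse (\<chi> 64) / q ^ 2 * (R * cnj R) - inverse (\<chi> 64) / q -
      (q - 1) / q ^ 3 * inverse (\<chi> 64) * \<phi> 2 * (q * char_delta (\<chi> ^ 2 * \<phi>))"
  proof -
    have "c / q ^ 2 * (X - q - f * ((q - 1) * d)) =
        c / q ^ 2 * X - c / q - (q - 1) / q ^ 3 * c * f * (q * d)" for c X f d :: complex
      using q by (simp add: divide_simps power2_eq_square power3_eq_cube) (simp add: algebra_simps)
    thus ?thesis .
  qed
  finally show ?thesis
    unfolding delta [symmetric] main [symmetric] Let_def
    by (simp add: powers A_powers binoms mult.assoc flip: \<chi>_def \<phi>_def q_def g_def)
qed

end
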